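(* Consider transmitting a binary source $S\sim\mathrm{Bern}(1/2)$ with Hamming distortion over a $K$-user binary broadcast channel $Y_k=X\oplus W_k$, $W_k\sim\mathrm{Bern}(p_k)$, $\frac12\ge p_1\ge\cdots\ge p_K\ge0$, with bandwidth mismatch factor $b$, where receiver $k$ observes side information $Z_k$ with $S=Z_k\oplus B_k$, $Z_k\sim\mathrm{Bern}(1/2)$ and $B_k\sim\mathrm{Bern}(\beta_k)$ independent, and $\frac12\ge\beta_1\ge\beta_2\ge\cdots\ge\beta_K\ge0$. Then $\mathcal{R}_{\mathrm{SI}}\subseteq\mathcal{R}_{\mathrm{SI\text{-}D}}^{(o)}$, where $\mathcal{R}_{\mathrm{SI\text{-}D}}^{(o)}$ is the set of $D_{[1:K]}$ for which there exist $0\le\alpha_1,\dots,\alpha_K\le\frac12$ with $\alpha_k\le D'_k\triangleq\min\{D_k,\beta_k\}$ for $1\le k\le K$, such that for all $\frac12=\tau_0\ge\tau_1\ge\cdots\ge\tau_K=0$, $$\frac1b\Big(\eta_k\big(H_2(\beta_k\star\tau_k)-H_2(\beta_k\star\tau_{k-1})-(H_4(\alpha_k,\beta_k,\tau_k)-H_4(\alpha_k,\beta_k,\tau_{k-1}))\big):k\in[1:K]\Big)\in\mathcal{C}_{BBC},$$ where $\eta_k=\frac{\beta_k-D'_k}{\beta_k-\alpha_k}$ if $\alpha_k<\beta_k$ and $\eta_k=0$ otherwise, and $\mathcal{C}_{BBC}$ is the set of $R_{[1:K]}$ for which there exist $\frac12=\theta_0\ge\theta_1\ge\cdots\ge\theta_K=0$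 with $0\le R_k\le H_2(\theta_{k-1}\star p_k)-H_2(\theta_k\star p_k)$ for $1\le k\le K$.
   Context: $x\star y=(1-x)y+x(1-y)$, $\bar x=1-x$, $H_2(p)=-p\log p-(1-p)\log(1-p)$ (base 2), and $H_4(x,y,z)=-(xyz+\bar x\bar y\bar z)\log(xyz+\bar x\bar y\bar z)-(x\bar yz+\bar xy\bar z)\log(x\bar yz+\bar xy\bar z)-(xy\bar z+\bar x\bar yz)\log(xy\bar z+\bar x\bar yz)-(x\bar y\bar z+\bar xyz)\log(x\bar y\bar z+\bar xyz)$. Hamming distortion $d(s,\hat s)=1\{s\ne\hat s\}$. The source and side informations $(S_t,Z_{1,t},\dots,Z_{K,t})$ are i.i.d. over $t$. Bandwidth mismatch with side information: a code maps $m$ source samples $S^m$ to $n$ channel inputs $X^n$, decoder $k$ maps $(Y_k^n,Z_k^m)$ to $\hat S_k^m$, and $b=n/m$. A tuple $D_{[1:K]}$ is achievable if some sequence of such codes has $\limsup\frac1m\sum_{t=1}^m\mathbb{P}(S_t\ne\hat S_{k,t})\le D_k$ for all $k$; $\mathcal{R}_{\mathrm{SI}}$ is the set of achievable tuples. *)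

theory Defs
  imports Complex_Main "HOL-Library.FuncSet" "HOL-Library.Extended_Real" "HOL-Library.Liminf_Limsup"
begin

definition bstar :: "real \<Rightarrow> real \<Rightarrow> real" where
  "bstar x y = (1 - x) * y + x * (1 - y)"

text \<open>-x log2 x (which is 0 at x = 0, since 0 * _ = 0).\<close>
definition nlog :: "real \<Rightarrow> real" where
  "nlog x = - x * log 2 x"

definition H2 :: "real \<Rightarrow> real" where
  "H2 q = - q * log 2 q - (1 - q) * log 2 (1 - q)"

definition H4 :: "real \<Rightarrow> real \<Rightarrow> real \<Rightarrow> real" where
  "H4 x y z =
     nlog (x*y*z + (1-x)*(1-y)*(1-z))
   + nlog (x*(1-y)*z + (1-x)*y*(1-z))
   + nlog (x*y*(1-z) + (1-x)*(1-y)*z)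
   + nlog (x*(1-y)*(1-z) + (1-x)*y*z)"

definition seqs :: "nat \<Rightarrow> (nat \<Rightarrow> bool) set" where
  "seqs l = {..<l} \<rightarrow>\<^sub>E (UNIV :: bool set)"

definition bern_seq :: "real \<Rightarrow> nat \<Rightarrow> (nat \<Rightarrow> bool) \<Rightarrow> real" where
  "bern_seq q l v = (\<Prod>i<l. if v i then q else 1 - q)"

text \<open>For receiver with channel crossover q and side-information parameter bt,
  code (m source samples, n channel uses, encoder f, decoder g):
  probability that P(S_t \<noteq> \<hat>S_t).  Z^m i.i.d. Bern(1/2), B^m i.i.d. Bern(bt),
  W^n i.i.d. Bern(q), all independent; S = Z xor B, X^n = f(S^m),
  Y^n = X^n xor W^n, \<hat>S^m = g(Y^n, Z^m).\<close>
definition err_prob ::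
  "real \<Rightarrow> real \<Rightarrow> nat \<Rightarrow> nat \<Rightarrow> ((nat \<Rightarrow> bool) \<Rightarrow> (nat \<Rightarrow> bool))
    \<Rightarrow> ((nat \<Rightarrow> bool) \<Rightarrow> (nat \<Rightarrow> bool) \<Rightarrow> (nat \<Rightarrow> bool)) \<Rightarrow> nat \<Rightarrow> real" where
  "err_prob q bt m n f g t =
     (\<Sum>z\<in>seqs m. \<Sum>bb\<in>seqs m. \<Sum>w\<in>seqs n.
        let s = restrict (\<lambda>i. z i \<noteq> bb i) {..<m};
            y = restrict (\<lambda>i. f s i \<noteq> w i) {..<n}
        in (1/2) ^ m * bern_seq bt m bb * bern_seq q n w *
           (if g y z t \<noteq> s t then 1 else 0))"

definition achievable_SI ::
  "nat \<Rightarrow> real \<Rightarrow> (nat \<Rightarrow> real) \<Rightarrow> (nat \<Rightarrow> real) \<Rightarrow> (nat \<Rightarrow> real) \<Rightarrow> bool" where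
  "achievable_SI K b p \<beta> D \<longleftrightarrow>
     (\<exists>(ms :: nat \<Rightarrow> nat) (ns :: nat \<Rightarrow> nat)
        (f :: nat \<Rightarrow> ((nat \<Rightarrow> bool) \<Rightarrow> (nat \<Rightarrow> bool)))
        (g :: nat \<Rightarrow> nat \<Rightarrow> ((nat \<Rightarrow> bool) \<Rightarrow> (nat \<Rightarrow> bool) \<Rightarrow> (nat \<Rightarrow> bool))).
        filterlim ms at_top sequentially \<and>
        (\<forall>j. 0 < ms j \<and> real (ns j) = b * real (ms j)) \<and>
        (\<forall>k\<in>{1..K}.
           limsup (\<lambda>j. ereal ((1 / real (ms j)) *
              (\<Sum>t<ms j. err_prob (p k) (\<beta> k) (ms j) (ns j) (f j) (g j k) t)))
           \<le> ereal (D k)))"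

definition eta :: "real \<Rightarrow> real \<Rightarrow> real \<Rightarrow> real" where
  "eta \<alpha> \<beta> D' = (if \<alpha> < \<beta> then (\<beta> - D') / (\<beta> - \<alpha>) else 0)"

definition C_BBC :: "nat \<Rightarrow> (nat \<Rightarrow> real) \<Rightarrow> (nat \<Rightarrow> real) \<Rightarrow> bool" where
  "C_BBC K p R \<longleftrightarrow>
     (\<exists>\<theta> :: nat \<Rightarrow> real. \<theta> 0 = 1/2 \<and> \<theta> K = 0 \<and> (\<forall>k\<in>{1..K}. \<theta> k \<le> \<theta> (k - 1)) \<and>
        (\<forall>k\<in>{1..K}. 0 \<le> R k \<and>
            R k \<le> H2 (bstar (\<theta> (k - 1)) (p k)) - H2 (bstar (\<theta> k) (p k))))"

definition R_SI_D_outer ::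
  "nat \<Rightarrow> real \<Rightarrow> (nat \<Rightarrow> real) \<Rightarrow> (nat \<Rightarrow> real) \<Rightarrow> (nat \<Rightarrow> real) \<Rightarrow> bool" where
  "R_SI_D_outer K b p \<beta> D \<longleftrightarrow>
     (\<exists>\<alpha> :: nat \<Rightarrow> real.
        (\<forall>k\<in>{1..K}. 0 \<le> \<alpha> k \<and> \<alpha> k \<le> 1/2 \<and> \<alpha> k \<le> min (D k) (\<beta> k)) \<and>
        (\<forall>\<tau> :: nat \<Rightarrow> real.
           \<tau> 0 = 1/2 \<and> \<tau> K = 0 \<and> (\<forall>k\<in>{1..K}. \<tau> k \<le> \<tau> (k - 1)) \<longrightarrow>
           C_BBC K p (\<lambda>k. (1 / b) *
             (eta (\<alpha> k) (\<beta> k) (min (D k) (\<beta> k)) *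
               (H2 (bstar (\<beta> k) (\<tau> k)) - H2 (bstar (\<beta> k) (\<tau> (k - 1)))
                - (H4 (\<alpha> k) (\<beta> k) (\<tau> k) - H4 (\<alpha> k) (\<beta> k) (\<tau> (k - 1))))))))"

end

theory Submission
  imports Defs "HOL-Analysis.Analysis" "HOL-Real_Asymp.Real_Asymp"
begin

text \<open>Let \<open>V k\<close> be the source seen through a binary symmetric channel with crossover
  \<open>\<tau> k\<close>, so that \<open>V 0\<close> is pure noise and \<open>V K\<close> is the source. The conditional entropy
  \<open>E k \<tau>\<close> of the output of channel \<open>k\<close> given \<open>Z k\<close> and the \<open>\<tau>\<close>-noisy source is played off in
  two ways.

  On the channel side, \<open>\<theta> k\<close> is chosen with \<open>E k (\<tau> k) = n H2 (bstar (\<theta> k) (p k))\<close>. As receiver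
  \<open>k - 1\<close> is degraded with respect to receiver \<open>k\<close> in both its channel and its side information,
  Mrs. Gerber's lemma yields \<open>E k (\<tau> (k - 1)) \<le> n H2 (bstar (\<theta> (k - 1)) (p k))\<close>, which bounds the increment
  \<open>E k (\<tau> (k - 1)) - E k (\<tau> k)\<close> from above.

  On the source side, this increment is a mutual information between remote source and channel
  output. It single-letterizes into terms that are convex in the posterior law of one source bit,
  given everything but the side-information bit at the same place. Where the decoder's guess depends
  on that last bit, it errs with probability at least \<open>\<beta> k\<close>; the remaining places form a fraction of at
  least \<open>\<eta> k\<close>, have average error \<open>\<alpha> k\<close>, and their convex terms give the bound in \<open>H4\<close>. As \<open>\<alpha> k\<close> depends
  on the code only, and not on \<open>\<tau>\<close>, compactness allows the passage to the limit.\<close>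

section \<open>Entropy of finite measures\<close>

text \<open>The region asks for one \<open>\<alpha>\<close> that serves every \<open>\<tau>\<close>,
  whereas the quantity bounded on the source side depends on \<open>\<tau>\<close>. The analysis of
  the decoder's guesses is therefore carried out for all subadditive, homogeneous, flip-invariant
  functionals of the law of a bit at once (\<open>sublinear_symmetric\<close>):
  \<open>\<alpha>\<close> is read off from the guesses, and \<open>\<tau>\<close> enters only
  afterwards, through the choice of the functional.

  Laws are unnormalized measures, for which concavity and homogeneity of entropy merge into
  superadditivity. In the same spirit Mrs. Gerber's lemma is used through supporting lines: a linear
  inequality passes through the chain rule and through sums over the conditioning without any appeal
  to Jensen's inequality.

  Two degenerate cases shape the rest. A channel with crossover \<open>1/2\<close> leaves
  \<open>\<theta> k\<close> undetermined, so the value \<open>1/2\<close> is carried along the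
  recursion. And \<open>eta\<close> can jump where \<open>\<alpha> k\<close> reaches
  \<open>\<beta> k\<close>, so the limit is treated separately there.\<close>

lemma nlog_0 [simp]: "nlog 0 = 0" and nlog_1 [simp]: "nlog 1 = 0"
  by (simp_all add: nlog_def)

lemma nlog_mult:
  assumes "0 \<le> x" "0 \<le> y"
  shows "nlog (x * y) = x * nlog y + y * nlog x"
proof (cases "x = 0 \<or> y = 0")
  case False
  with assms have "0 < x" "0 < y" by auto
  then show ?thesis by (simp add: nlog_def log_mult algebra_simps)
qed auto

lemma H2_nlog: "H2 q = nlog q + nlog (1 - q)"
  by (simp add: H2_def nlog_def algebra_simps)

text \<open>The function \<open>a log (V / a)\<close> is homogeneous and jointly concave in
  \<open>a\<close> and \<open>V\<close>, hence superadditive. For positive arguments this is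
  \<open>ln x \<le> x - 1\<close>, applied with weights that make the right sides cancel.\<close>

lemma log_sum_two:
  assumes "0 \<le> a" "a \<le> V" "0 \<le> b" "b \<le> W"
  shows "nlog a + a * log 2 V + (nlog b + b * log 2 W)
    \<le> nlog (a + b) + (a + b) * log 2 (V + W)"
proof -
  consider "a = 0" "b = 0" | "a = 0" "0 < b" | "0 < a" "b = 0" | "0 < a" "0 < b"
    using assms by linarith
  then show ?thesis
  proof cases
    case 4
    let ?x = "V * (a + b) / (a * (V + W))" and ?y = "W * (a + b) / (b * (V + W))"
    have pos: "0 < V" "0 < W" using 4 assms by auto
    have "a * ln ?x + b * ln ?y \<le> a * (?x - 1) + b * (?y - 1)"
      using 4 pos by (intro add_mono mult_left_mono ln_le_minus_one) auto
    also have "\<dots> = 0"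
    proof -
      have "a * ?x = V * (a + b) / (V + W)" "b * ?y = W * (a + b) / (V + W)"
        using 4 by auto
      moreover have "V * (a + b) / (V + W) + W * (a + b) / (V + W) = a + b"
        using pos by (simp add: add_divide_distrib [symmetric] distrib_right [symmetric])
      ultimately show ?thesis by (simp add: right_diff_distrib)
    qed
    finally have "a * ln ?x + b * ln ?y \<le> 0" .
    then have "a * (ln V + ln (a + b) - ln a - ln (V + W))
        + b * (ln W + ln (a + b) - ln b - ln (V + W)) \<le> 0"
    proof -
      have "ln ?x = ln V + ln (a + b) - ln a - ln (V + W)"
        using 4 pos by (subst ln_div) (simp_all add: ln_mult)
      moreover have "ln ?y = ln W + ln (a + b) - ln b - ln (V + W)"
        using 4 pos by (subst ln_div) (simp_all add: ln_mult)
      ultimately show ?thesis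
        using \<open>a * ln ?x + b * ln ?y \<le> 0\<close> by simp
    qed
    then have "(- a * ln a + a * ln V + (- b * ln b + b * ln W)) / ln 2
      \<le> (- (a + b) * ln (a + b) + (a + b) * ln (V + W)) / ln 2"
      by (intro divide_right_mono) (auto simp: algebra_simps)
    then show ?thesis
      by (simp add: nlog_def log_def add_divide_distrib diff_divide_distrib)
  qed (use assms in \<open>auto simp: nlog_def\<close>)
qed

text \<open>\<open>Phi A v\<close> is the mass of \<open>v\<close> times the entropy of the normalized \<open>v\<close>. A conditional entropy is
  thus a sum of values of \<open>Phi\<close> over the conditioning variable, without any division.\<close>

definition Phi :: "'a set \<Rightarrow> ('a \<Rightarrow> real) \<Rightarrow> real" where
  "Phi A v = (\<Sum>x\<in>A. nlog (v x)) - nlog (\<Sum>x\<in>A. v x)"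

lemma Phi_cong: "(\<And>x. x \<in> A \<Longrightarrow> v x = w x) \<Longrightarrow> Phi A v = Phi A w"
  by (simp add: Phi_def)

lemma Phi_zero [simp]: "Phi A (\<lambda>_. 0) = 0"
  by (simp add: Phi_def)

text \<open>Concavity of entropy for unnormalized laws: mixing \<open>v\<close> and \<open>w\<close>
  forgets which of the two was drawn, and forgetting a conditioning variable cannot lower the
  entropy.\<close>

lemma Phi_add:
  assumes "finite A" "\<And>x. x \<in> A \<Longrightarrow> 0 \<le> v x" "\<And>x. x \<in> A \<Longrightarrow> 0 \<le> w x"
  shows "Phi A v + Phi A w \<le> Phi A (\<lambda>x. v x + w x)"
proof -
  have *: "Phi A u = (\<Sum>x\<in>A. nlog (u x) + u x * log 2 (sum u A))" for u
    by (simp add: Phi_def nlog_def [of "sum u A"] sum.distrib sum_distrib_right)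
  have "Phi A v + Phi A w = (\<Sum>x\<in>A. nlog (v x) + v x * log 2 (sum v A)
      + (nlog (w x) + w x * log 2 (sum w A)))"
    by (simp add: * sum.distrib)
  also have "\<dots> \<le> (\<Sum>x\<in>A. nlog (v x + w x) + (v x + w x) * log 2 (sum v A + sum w A))"
    using assms by (intro sum_mono log_sum_two member_le_sum) auto
  also have "\<dots> = Phi A (\<lambda>x. v x + w x)"
    by (simp add: * sum.distrib)
  finally show ?thesis .
qed

lemma Phi_sum:
  assumes "finite A" "finite I" "\<And>i x. i \<in> I \<Longrightarrow> x \<in> A \<Longrightarrow> 0 \<le> v i x"
  shows "(\<Sum>i\<in>I. Phi A (v i)) \<le> Phi A (\<lambda>x. \<Sum>i\<in>I. v i x)"
  using assms(2,3)
proof (induction I)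
  case (insert i I)
  have "Phi A (v i) + Phi A (\<lambda>x. \<Sum>i\<in>I. v i x) \<le> Phi A (\<lambda>x. v i x + (\<Sum>i\<in>I. v i x))"
    using assms(1) insert.prems by (intro Phi_add) (auto intro: sum_nonneg)
  then show ?case using insert by force
qed simp

lemma Phi_scale:
  assumes "0 \<le> c" "\<And>x. x \<in> A \<Longrightarrow> 0 \<le> v x"
  shows "Phi A (\<lambda>x. c * v x) = c * Phi A v"
  using assms
  by (simp add: Phi_def nlog_mult sum_nonneg sum_distrib_left [symmetric] sum.distrib
      sum_distrib_right [symmetric] algebra_simps)

section \<open>Sums over binary sequences\<close>

lemma finite_seqs [simp]: "finite (seqs l)"
  by (simp add: seqs_def finite_PiE)

lemma card_seqs: "card (seqs l) = 2 ^ l"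
  by (simp add: seqs_def card_PiE)

lemma seqs_0: "seqs 0 = {\<lambda>_. undefined}"
  by (simp add: seqs_def)

lemma sum_seqs_Suc:
  fixes F :: "(nat \<Rightarrow> bool) \<Rightarrow> real"
  shows "(\<Sum>y\<in>seqs (Suc l). F y) = (\<Sum>y\<in>seqs l. \<Sum>b\<in>UNIV. F (y(l := b)))"
proof -
  have "(\<Sum>y\<in>seqs l. \<Sum>b\<in>UNIV. F (y(l := b))) = (\<Sum>(b, y)\<in>UNIV \<times> seqs l. F (y(l := b)))"
    by (subst sum.swap) (simp add: sum.cartesian_product)
  also have "\<dots> = sum F ((\<lambda>(b, y). y(l := b)) ` (UNIV \<times> seqs l))"
    by (subst sum.reindex)
      (use inj_combinator [of l "{..<l}" "\<lambda>_. UNIV :: bool set"]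
        in \<open>auto simp: seqs_def case_prod_beta\<close>)
  also have "(\<lambda>(b, y). y(l := b)) ` (UNIV \<times> seqs l) = seqs (Suc l)"
    by (simp add: seqs_def lessThan_Suc PiE_insert_eq)
  finally show ?thesis by (rule sym)
qed

section \<open>Binary symmetric kernels\<close>

definition bk :: "real \<Rightarrow> bool \<Rightarrow> bool \<Rightarrow> real" where
  "bk q a b = (if a \<noteq> b then q else 1 - q)"

definition ker :: "real \<Rightarrow> nat \<Rightarrow> (nat \<Rightarrow> bool) \<Rightarrow> (nat \<Rightarrow> bool) \<Rightarrow> real" where
  "ker q l x y = (\<Prod>i<l. bk q (x i) (y i))"

lemma bk_nonneg: "0 \<le> q \<Longrightarrow> q \<le> 1 \<Longrightarrow> 0 \<le> bk q a b"
  by (simp add: bk_def)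

lemma bk_sym: "bk q a b = bk q b a"
  by (auto simp: bk_def)

lemma sum_bk [simp]: "(\<Sum>b\<in>UNIV. bk q a b) = 1"
  by (cases a) (auto simp: UNIV_bool bk_def)

lemma bk_comp: "(\<Sum>b\<in>UNIV. bk q a b * bk r b c) = bk (bstar q r) a c"
  by (cases a; cases c) (auto simp: UNIV_bool bk_def bstar_def algebra_simps)

lemma ker_nonneg: "0 \<le> q \<Longrightarrow> q \<le> 1 \<Longrightarrow> 0 \<le> ker q l x y"
  by (simp add: ker_def prod_nonneg bk_nonneg)

lemma ker_sym: "ker q l x y = ker q l y x"
  by (simp add: ker_def bk_sym)

lemma sum_seqs_prod:
  fixes g :: "nat \<Rightarrow> bool \<Rightarrow> real"
  shows "(\<Sum>y\<in>seqs l. \<Prod>i<l. g i (y i)) = (\<Prod>i<l. \<Sum>b\<in>UNIV. g i b)"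
  unfolding seqs_def by (rule prod_sum_PiE [symmetric]) auto

lemma sum_ker [simp]: "(\<Sum>y\<in>seqs l. ker q l x y) = 1"
  by (simp add: ker_def sum_seqs_prod [where g = "\<lambda>i b. bk q (x i) b"])

lemma ker_comp: "(\<Sum>y\<in>seqs l. ker q l x y * ker r l y z) = ker (bstar q r) l x z"
  by (simp add: ker_def prod.distrib [symmetric] bk_comp
      sum_seqs_prod [where g = "\<lambda>i b. bk q (x i) b * bk r b (z i)"])

lemma ker_Suc_upd [simp]: "ker q (Suc l) (x(l := a)) (y(l := b)) = ker q l x y * bk q a b"
  by (simp add: ker_def)

lemma ker_Suc_upd2 [simp]: "ker q (Suc l) x (y(l := b)) = ker q l x y * bk q (x l) b"
  by (simp add: ker_def)

lemma ker_marginal: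
  assumes "t < l"
  shows "(\<Sum>y | y \<in> seqs l \<and> y t = b. ker q l x y) = bk q (x t) b"
proof -
  \<comment> \<open>The event \<open>y t = b\<close> is written as a product of one factor per
    coordinate, so that the whole sum factors.\<close>
  let ?g = "\<lambda>i c. bk q (x i) c * (if i = t \<and> c \<noteq> b then 0 else 1)"
  have ind: "(\<Prod>i<l. if i = t \<and> y i \<noteq> b then 0 else (1::real)) = (if y t = b then 1 else 0)" for y
  proof (cases "y t = b")
    case True
    then show ?thesis by (simp add: prod.neutral)
  next
    case False
    then show ?thesis using assms by (auto intro!: prod_zero)
  qed
  have "(\<Sum>y | y \<in> seqs l \<and> y t = b. ker q l x y) = (\<Sum>y\<in>seqs l. \<Prod>i<l. ?g i (y i))"
  proof (rule sum.mono_neutral_cong_left)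
    show "\<forall>y\<in>seqs l - {y \<in> seqs l. y t = b}. (\<Prod>i<l. ?g i (y i)) = 0"
      unfolding prod.distrib ind by simp
    show "ker q l x y = (\<Prod>i<l. ?g i (y i))" if "y \<in> {y \<in> seqs l. y t = b}" for y
      using that unfolding prod.distrib ind by (simp add: ker_def)
  qed auto
  also have "\<dots> = (\<Prod>i<l. \<Sum>c\<in>UNIV. ?g i c)"
    by (rule sum_seqs_prod)
  also have "\<dots> = (\<Prod>i<l. if i = t then bk q (x t) b else 1)"
    by (intro prod.cong refl) (auto simp: UNIV_bool bk_def)
  also have "\<dots> = bk q (x t) b" using assms by simp
  finally show ?thesis .
qed

text \<open>The output law of a memoryless binary symmetric channel with crossover \<open>q\<close>
  whose input has the unnormalized law \<open>v\<close>; \<open>nb\<close> is the version for a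
  single bit.\<close>

definition nz :: "real \<Rightarrow> nat \<Rightarrow> ((nat \<Rightarrow> bool) \<Rightarrow> real) \<Rightarrow> (nat \<Rightarrow> bool) \<Rightarrow> real" where
  "nz q l v y = (\<Sum>x\<in>seqs l. ker q l x y * v x)"

definition nb :: "real \<Rightarrow> (bool \<Rightarrow> real) \<Rightarrow> bool \<Rightarrow> real" where
  "nb q u b = (\<Sum>a\<in>UNIV. bk q a b * u a)"

lemma nb_nonneg: "0 \<le> q \<Longrightarrow> q \<le> 1 \<Longrightarrow> (\<And>a. 0 \<le> u a) \<Longrightarrow> 0 \<le> nb q u b"
  by (simp add: nb_def sum_nonneg bk_nonneg)

lemma nb_nb: "nb r (nb q u) = nb (bstar q r) u"
  by (rule ext) (simp add: nb_def UNIV_bool bk_def bstar_def algebra_simps)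

text \<open>The chain rule: the masses of the prefixes enter the two terms on the right with
  opposite signs and cancel, and the second term is the conditional entropy of the last bit given
  its prefix.\<close>

lemma Phi_seqs_Suc:
  "Phi (seqs (Suc l)) v =
    Phi (seqs l) (\<lambda>y. \<Sum>b\<in>UNIV. v (y(l := b))) + (\<Sum>y\<in>seqs l. Phi UNIV (\<lambda>b. v (y(l := b))))"
  by (simp add: Phi_def sum_seqs_Suc sum_subtractf)

lemma Phi_bk: "Phi UNIV (bk q a) = H2 q"
  by (cases a) (simp_all add: Phi_def UNIV_bool bk_def H2_nlog)

lemma Phi_ker:
  assumes "0 \<le> q" "q \<le> 1"
  shows "Phi (seqs l) (ker q l x) = l * H2 q"
proof (induction l)
  case 0
  then show ?case by (simp add: Phi_def seqs_0 ker_def)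
next
  case (Suc l)
  have "Phi UNIV (\<lambda>b. ker q l x y * bk q (x l) b) = ker q l x y * H2 q" for y
    using assms by (simp add: Phi_scale ker_nonneg bk_nonneg Phi_bk)
  with Suc show ?case
    by (simp add: Phi_seqs_Suc sum_distrib_left [symmetric] sum_distrib_right [symmetric]
        distrib_right)
qed

text \<open>The tensorization step behind both Mrs. Gerber's lemma and the source converse:
  the past of the noisy sequence carries less information about its next bit than the past
  of the clean one.\<close>

lemma Phi_nz_Suc:
  assumes q: "0 \<le> q" "q \<le> 1" and v: "\<And>y. y \<in> seqs (Suc l) \<Longrightarrow> 0 \<le> v y"
  shows "Phi (seqs l) (nz q l (\<lambda>y. \<Sum>b\<in>UNIV. v (y(l := b))))
      + (\<Sum>y\<in>seqs l. Phi UNIV (nb q (\<lambda>b. v (y(l := b)))))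
    \<le> Phi (seqs (Suc l)) (nz q (Suc l) v)"
proof -
  have v': "0 \<le> v (y(l := b))" if "y \<in> seqs l" for y b
    using that v by (auto simp: seqs_def PiE_iff extensional_def)
  have nzS: "nz q (Suc l) v (y(l := b)) = (\<Sum>x\<in>seqs l. ker q l x y * nb q (\<lambda>b. v (x(l := b))) b)"
    for y b
    by (simp add: nz_def nb_def sum_seqs_Suc sum_distrib_left mult_ac del: ker_Suc_upd2)
  have "(\<Sum>b\<in>UNIV. nz q (Suc l) v (y(l := b))) = nz q l (\<lambda>y. \<Sum>b\<in>UNIV. v (y(l := b))) y" for y
  proof -
    have "(\<Sum>b\<in>UNIV. nb q u b) = (\<Sum>b\<in>UNIV. u b)" for u
      by (simp add: nb_def UNIV_bool bk_def algebra_simps)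
    then show ?thesis
      unfolding nzS by (subst sum.swap) (simp add: nz_def sum_distrib_left [symmetric])
  qed
  moreover have "(\<Sum>y\<in>seqs l. Phi UNIV (nb q (\<lambda>b. v (y(l := b)))))
    \<le> (\<Sum>y\<in>seqs l. Phi UNIV (\<lambda>b. nz q (Suc l) v (y(l := b))))"
  proof -
    \<comment> \<open>The clean prefix \<open>x\<close> is replaced by its noisy copy
      \<open>y\<close> as conditioning variable: the weights \<open>ker q l x y\<close> sum to 1
      over \<open>y\<close>, and regrouping by \<open>y\<close> mixes the laws over
      \<open>x\<close>, which can only increase \<open>Phi\<close>.\<close>
    have "(\<Sum>x\<in>seqs l. Phi UNIV (nb q (\<lambda>b. v (x(l := b)))))
        = (\<Sum>x\<in>seqs l. (\<Sum>y\<in>seqs l. ker q l x y) * Phi UNIV (nb q (\<lambda>b. v (x(l := b)))))"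
      by simp
    also have "\<dots> = (\<Sum>y\<in>seqs l. \<Sum>x\<in>seqs l. ker q l x y * Phi UNIV (nb q (\<lambda>b. v (x(l := b)))))"
      by (subst sum.swap) (simp only: sum_distrib_right)
    also have "\<dots> = (\<Sum>y\<in>seqs l. \<Sum>x\<in>seqs l. Phi UNIV (\<lambda>b. ker q l x y * nb q (\<lambda>b. v (x(l := b))) b))"
      using q v' by (intro sum.cong refl Phi_scale [symmetric]) (auto intro: ker_nonneg nb_nonneg)
    also have "\<dots> \<le> (\<Sum>y\<in>seqs l. Phi UNIV (\<lambda>b. \<Sum>x\<in>seqs l. ker q l x y * nb q (\<lambda>b. v (x(l := b))) b))"
      using q v' by (intro sum_mono Phi_sum) (auto intro!: ker_nonneg nb_nonneg mult_nonneg_nonneg)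
    finally show ?thesis by (simp add: nzS)
  qed
  ultimately show ?thesis by (simp add: Phi_seqs_Suc)
qed

definition rho :: "real \<Rightarrow> (bool \<Rightarrow> real) \<Rightarrow> real" where
  "rho q u = Phi UNIV (nb q u) - Phi UNIV u"

text \<open>The entropy of the output minus that of the input is the entropy of the noise minus the
  conditional entropy of the input given the output; hence subadditivity.\<close>

lemma rho_eq:
  assumes "0 \<le> q" "q \<le> 1" "\<And>a. 0 \<le> u a"
  shows "rho q u = (\<Sum>a\<in>UNIV. u a) * H2 q - (\<Sum>b\<in>UNIV. Phi UNIV (\<lambda>a. u a * bk q a b))"
proof -
  have "rho q u = (\<Sum>b\<in>UNIV. nlog (nb q u b)) - (\<Sum>a\<in>UNIV. nlog (u a))"
    by (simp add: rho_def Phi_def nb_def UNIV_bool bk_def algebra_simps)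
  moreover have "(\<Sum>b\<in>UNIV. \<Sum>a\<in>UNIV. nlog (u a * bk q a b))
      = (\<Sum>a\<in>UNIV. u a) * H2 q + (\<Sum>a\<in>UNIV. nlog (u a))"
    using assms by (simp add: UNIV_bool bk_def nlog_mult H2_nlog algebra_simps)
  ultimately show ?thesis
    by (simp add: Phi_def sum_subtractf nb_def mult.commute)
qed

lemma rho_sum:
  assumes "0 \<le> q" "q \<le> 1" "finite I" "\<And>i a. i \<in> I \<Longrightarrow> 0 \<le> u i a"
  shows "rho q (\<lambda>a. \<Sum>i\<in>I. u i a) \<le> (\<Sum>i\<in>I. rho q (u i))"
proof -
  have "(\<Sum>b\<in>UNIV. \<Sum>i\<in>I. Phi UNIV (\<lambda>a. u i a * bk q a b))
      \<le> (\<Sum>b\<in>UNIV. Phi UNIV (\<lambda>a. (\<Sum>i\<in>I. u i a) * bk q a b))"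
    unfolding sum_distrib_right
    using assms by (intro sum_mono Phi_sum) (auto simp: bk_nonneg)
  moreover have "(\<Sum>b\<in>UNIV. \<Sum>i\<in>I. Phi UNIV (\<lambda>a. u i a * bk q a b))
      = (\<Sum>i\<in>I. \<Sum>b\<in>UNIV. Phi UNIV (\<lambda>a. u i a * bk q a b))"
    by (rule sum.swap)
  moreover have "(\<Sum>a\<in>UNIV. \<Sum>i\<in>I. u i a) = (\<Sum>i\<in>I. \<Sum>a\<in>UNIV. u i a)"
    by (rule sum.swap)
  ultimately show ?thesis
    using assms by (simp add: rho_eq sum_nonneg sum_subtractf sum_distrib_right cong: sum.cong del: sum_bk)
qed

lemma rho_nb: "rho d (nb q u) = Phi UNIV (nb (bstar q d) u) - Phi UNIV (nb q u)"
  by (simp add: rho_def nb_nb)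

lemma seqs_upd: "y \<in> seqs l \<Longrightarrow> y(l := b) \<in> seqs (Suc l)"
  by (auto simp: seqs_def PiE_iff extensional_def)

lemma seqs_upd_less: "y \<in> seqs l \<Longrightarrow> t < l \<Longrightarrow> y(t := b) \<in> seqs l"
  by (auto simp: seqs_def PiE_iff extensional_def)

lemma sum_seqs_Suc_filter:
  fixes v :: "(nat \<Rightarrow> bool) \<Rightarrow> real"
  assumes "t < l"
  shows "(\<Sum>y | y \<in> seqs (Suc l) \<and> y t = b. v y)
    = (\<Sum>y | y \<in> seqs l \<and> y t = b. \<Sum>c\<in>UNIV. v (y(l := c)))"
proof -
  have "(\<Sum>y | y \<in> seqs (Suc l) \<and> y t = b. v y) = (\<Sum>y\<in>seqs (Suc l). if y t = b then v y else 0)"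
    by (rule sum.mono_neutral_cong_left) auto
  also have "\<dots> = (\<Sum>y\<in>seqs l. if y t = b then \<Sum>c\<in>UNIV. v (y(l := c)) else 0)"
    using assms by (auto simp: sum_seqs_Suc intro!: sum.cong)
  also have "\<dots> = (\<Sum>y | y \<in> seqs l \<and> y t = b. \<Sum>c\<in>UNIV. v (y(l := c)))"
    by (rule sum.mono_neutral_cong_right) auto
  finally show ?thesis .
qed

lemma sum_seqs_Suc_last:
  fixes v :: "(nat \<Rightarrow> bool) \<Rightarrow> real"
  shows "(\<Sum>y | y \<in> seqs (Suc l) \<and> y l = b. v y) = (\<Sum>y\<in>seqs l. v (y(l := b)))"
proof -
  have "(\<Sum>y | y \<in> seqs (Suc l) \<and> y l = b. v y) = (\<Sum>y\<in>seqs (Suc l). if y l = b then v y else 0)"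
    by (rule sum.mono_neutral_cong_left) auto
  also have "\<dots> = (\<Sum>y\<in>seqs l. v (y(l := b)))"
    by (cases b) (auto simp: sum_seqs_Suc UNIV_bool intro!: sum.cong)
  finally show ?thesis .
qed

text \<open>Single-letterization. By the chain rule and \<open>Phi_nz_Suc\<close>, appending a bit
  adds at least the sum of \<open>rho\<close> over the conditional laws of that bit given the clean
  prefix; subadditivity of \<open>rho\<close> then merges these into the marginal law of the
  bit.\<close>

lemma Phi_nz_ge_sum_rho:
  assumes q: "0 \<le> q" "q \<le> 1" and v: "\<And>y. y \<in> seqs l \<Longrightarrow> 0 \<le> v y"
  shows "(\<Sum>t<l. rho q (\<lambda>b. \<Sum>y | y \<in> seqs l \<and> y t = b. v y))
    \<le> Phi (seqs l) (nz q l v) - Phi (seqs l) v"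
  using v
proof (induction l arbitrary: v)
  case 0
  then show ?case by (simp add: nz_def Phi_def seqs_0 ker_def)
next
  case (Suc l)
  let ?v = "\<lambda>y. \<Sum>b\<in>UNIV. v (y(l := b))"
  have v': "0 \<le> v (y(l := b))" if "y \<in> seqs l" for y b
    using that Suc.prems seqs_upd by blast
  have "(\<Sum>t<l. rho q (\<lambda>b. \<Sum>y | y \<in> seqs (Suc l) \<and> y t = b. v y))
      = (\<Sum>t<l. rho q (\<lambda>b. \<Sum>y | y \<in> seqs l \<and> y t = b. ?v y))"
    by (intro sum.cong refl) (simp add: sum_seqs_Suc_filter)
  also have "\<dots> \<le> Phi (seqs l) (nz q l ?v) - Phi (seqs l) ?v"
    by (rule Suc.IH) (intro sum_nonneg v')
  finally have 1: "(\<Sum>t<l. rho q (\<lambda>b. \<Sum>y | y \<in> seqs (Suc l) \<and> y t = b. v y)) \<le> \<dots>" .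
  have "rho q (\<lambda>b. \<Sum>y | y \<in> seqs (Suc l) \<and> y l = b. v y)
      \<le> (\<Sum>y\<in>seqs l. rho q (\<lambda>b. v (y(l := b))))"
    unfolding sum_seqs_Suc_last by (rule rho_sum) (use q v' in auto)
  with 1 Phi_nz_Suc [of q l v, OF q Suc.prems] show ?case
    by (simp add: Phi_seqs_Suc [of l v] rho_def sum_subtractf)
qed

section \<open>Mrs. Gerber's lemma\<close>

lemma H2_sym: "H2 (1 - q) = H2 q"
  by (simp add: H2_nlog)

lemma H2_half: "H2 (1/2) = 1"
  by (simp add: H2_def log_divide)

lemma H2_0 [simp]: "H2 0 = 0" and H2_1 [simp]: "H2 1 = 0"
  by (simp_all add: H2_nlog)

lemma bstar_compl: "bstar q (1 - x) = 1 - bstar q x"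
  by (simp add: bstar_def algebra_simps)

lemma bstar_commute: "bstar q x = bstar x q"
  by (simp add: bstar_def algebra_simps)

lemma bstar_half [simp]: "bstar (1/2) x = 1/2" "bstar x (1/2) = 1/2"
  by (simp_all add: bstar_def field_simps)

lemma bstar_0 [simp]: "bstar 0 x = x" "bstar x 0 = x"
  by (simp_all add: bstar_def)

text \<open>In the coordinate \<open>1 - 2 * x\<close> the operation \<open>bstar\<close> is
  multiplication, which is why the calculus below works with that coordinate.\<close>

lemma half_minus_bstar: "1/2 - bstar q x = 2 * (1/2 - q) * (1/2 - x)"
  by (simp add: bstar_def field_simps)

lemma bstar_nonneg: "0 \<le> q \<Longrightarrow> q \<le> 1 \<Longrightarrow> 0 \<le> x \<Longrightarrow> x \<le> 1 \<Longrightarrow> 0 \<le> bstar q x"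
  by (simp add: bstar_def)

lemma bstar_le_1: "0 \<le> q \<Longrightarrow> q \<le> 1 \<Longrightarrow> 0 \<le> x \<Longrightarrow> x \<le> 1 \<Longrightarrow> bstar q x \<le> 1"
  using bstar_nonneg [of q "1 - x"] by (simp add: bstar_compl)

lemma continuous_on_bstar [continuous_intros]:
  "continuous_on S f \<Longrightarrow> continuous_on S g \<Longrightarrow> continuous_on S (\<lambda>x. bstar (f x) (g x))"
  unfolding bstar_def by (intro continuous_intros)

lemma bstar_le_half: "q \<le> 1/2 \<Longrightarrow> x \<le> 1/2 \<Longrightarrow> bstar q x \<le> 1/2"
  using half_minus_bstar [of q x] mult_nonneg_nonneg [of "1/2 - q" "1/2 - x"] by linarith

lemma bstar_mono: "q \<le> 1/2 \<Longrightarrow> x \<le> y \<Longrightarrow> bstar q x \<le> bstar q y"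
  using mult_nonneg_nonneg [of "1 - 2 * q" "y - x"] by (simp add: bstar_def algebra_simps)

lemma bstar_ge: "0 \<le> q \<Longrightarrow> x \<le> 1/2 \<Longrightarrow> x \<le> bstar q x"
  using mult_nonneg_nonneg [of q "1 - 2 * x"] by (simp add: bstar_def algebra_simps)

text \<open>A noisier binary symmetric channel is a cleaner one followed by further noise:
  \<open>d\<close> solves \<open>1 - 2 * y = (1 - 2 * x) * (1 - 2 * d)\<close>. This provides the
  degradations in the channel, in the side information and in the remote source.\<close>

lemma ex_bstar_factor:
  assumes "0 \<le> x" "x \<le> y" "y \<le> 1/2"
  obtains d where "0 \<le> d" "d \<le> 1/2" "y = bstar x d"
proof (cases "x = 1/2")
  case True
  with assms that [of 0] show ?thesis by simp
next
  case False
  with assms have *: "0 < 1 - 2 * x" by simp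
  show ?thesis
  proof (rule that [of "(y - x) / (1 - 2 * x)"])
    show "0 \<le> (y - x) / (1 - 2 * x)" using assms * by simp
    show "(y - x) / (1 - 2 * x) \<le> 1/2" using assms * by (simp add: field_simps)
    have "bstar x ((y - x) / (1 - 2 * x)) = x + (1 - 2 * x) * ((y - x) / (1 - 2 * x))"
      unfolding bstar_def by algebra
    then show "y = bstar x ((y - x) / (1 - 2 * x))" using * by simp
  qed
qed

lemma continuous_on_nlog: "continuous_on {0..} nlog"
proof -
  have "continuous (at x within {0..}) nlog" if "0 \<le> x" for x
  proof (cases "x = 0")
    case True
    have "(nlog \<longlongrightarrow> 0) (at_right 0)"
      unfolding nlog_def log_def by real_asymp
    then show ?thesis
      by (simp add: True continuous_within at_within_order [of 0] at_within_Ici_at_right)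
  next
    case False
    then have "isCont nlog x"
      using that unfolding nlog_def log_def by (auto intro!: continuous_intros)
    then show ?thesis by (rule continuous_at_imp_continuous_at_within)
  qed
  then show ?thesis by (simp add: continuous_on_eq_continuous_within)
qed

lemma continuous_on_nlog_compose [continuous_intros]:
  assumes "continuous_on S f" "\<And>x. x \<in> S \<Longrightarrow> 0 \<le> f x"
  shows "continuous_on S (\<lambda>x. nlog (f x))"
  by (rule continuous_on_compose2 [OF continuous_on_nlog assms(1)]) (use assms(2) in auto)

lemma continuous_on_H2 [continuous_intros]:
  assumes "continuous_on S f" "\<And>x. x \<in> S \<Longrightarrow> 0 \<le> f x" "\<And>x. x \<in> S \<Longrightarrow> f x \<le> 1"
  shows "continuous_on S (\<lambda>x. H2 (f x))"
  unfolding H2_nlog by (intro continuous_intros assms) (use assms in auto)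

lemma H2_deriv:
  assumes "0 < x" "x < 1"
  shows "(H2 has_real_derivative ln ((1 - x) / x) / ln 2) (at x)"
proof -
  have "((\<lambda>x. - x * ln x - (1 - x) * ln (1 - x)) has_real_derivative ln (1 - x) - ln x) (at x)"
    using assms by (auto intro!: derivative_eq_intros)
  then have "((\<lambda>x. (- x * ln x - (1 - x) * ln (1 - x)) / ln 2) has_real_derivative
      (ln (1 - x) - ln x) / ln 2) (at x)"
    by (rule DERIV_cdivide)
  moreover have "ln ((1 - x) / x) = ln (1 - x) - ln x"
    using assms by (subst ln_div) auto
  moreover have "H2 = (\<lambda>x. (- x * ln x - (1 - x) * ln (1 - x)) / ln 2)"
    by (rule ext) (simp add: H2_def log_def diff_divide_distrib)
  ultimately show ?thesis by simp
qed

text \<open>Turns the derivative of \<open>H2\<close> at \<open>x\<close> into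
  \<open>2 / ln 2\<close> times \<open>artanh (1 - 2 * x)\<close>.\<close>

lemma ln_ratio_artanh: "0 < (x::real) \<Longrightarrow> x < 1 \<Longrightarrow> ln ((1 - x) / x) = 2 * artanh (1 - 2 * x)"
proof -
  assume "0 < x" "x < 1"
  then have "(1 + (1 - 2 * x)) / (1 - (1 - 2 * x)) = (1 - x) / x"
    by (simp add: divide_simps)
  then show ?thesis by (simp add: artanh_def)
qed

section \<open>Monotonicity of quotients of \<open>artanh\<close>\<close>

lemma artanh_ge:
  assumes "0 \<le> (u::real)" "u < 1"
  shows "u \<le> artanh u"
proof -
  have "(\<lambda>u. artanh u - u) 0 \<le> (\<lambda>u. artanh u - u) u"
  proof (rule DERIV_nonneg_imp_nondecreasing [OF assms(1)])
    fix x :: real assume "0 \<le> x" "x \<le> u"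
    with assms have "x\<^sup>2 < 1" by (simp add: power_less_one_iff abs_square_less_1)
    moreover have "((\<lambda>u. artanh u - u) has_real_derivative (1 / (1 - x\<^sup>2) - 1)) (at x)"
      using \<open>0 \<le> x\<close> \<open>x \<le> u\<close> assms by (auto intro!: derivative_eq_intros)
    ultimately show "\<exists>y. ((\<lambda>u. artanh u - u) has_real_derivative y) (at x) \<and> 0 \<le> y"
      by (intro exI conjI) (auto simp: field_simps)
  qed
  then show ?thesis by simp
qed

lemma artanh_pos: "0 < (u::real) \<Longrightarrow> u < 1 \<Longrightarrow> 0 < artanh u"
  using artanh_ge [of u] by linarith

text \<open>The quotient is the reciprocal of the elasticity (logarithmic derivative with respect to
  \<open>ln u\<close>) of \<open>artanh\<close>. Its own derivative has the sign of
  \<open>u - (1 + u\<^sup>2) * artanh u\<close>, which is nonpositive by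
  \<open>artanh_ge\<close>.\<close>

lemma artanh_quotient_decreasing:
  assumes "0 < x" "x \<le> y" "y < (1::real)"
  shows "(1 - y\<^sup>2) * artanh y / y \<le> (1 - x\<^sup>2) * artanh x / x"
proof (rule DERIV_nonpos_imp_nonincreasing [OF assms(2)])
  fix u assume u: "x \<le> u" "u \<le> y"
  with assms have u01: "0 < u" "u < 1" by auto
  then have ne: "1 - u\<^sup>2 \<noteq> 0" by (simp add: power2_eq_1_iff)
  have "((\<lambda>u. (1 - u\<^sup>2) * artanh u) has_real_derivative 1 - 2 * u * artanh u) (at u)"
    using u01 ne by (auto intro!: derivative_eq_intros)
  then have "((\<lambda>u. (1 - u\<^sup>2) * artanh u / u) has_real_derivative
      ((1 - 2 * u * artanh u) * u - (1 - u\<^sup>2) * artanh u * 1) / (u * u)) (at u)"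
    using u01 by (intro DERIV_divide DERIV_ident) auto
  moreover have "(1 - 2 * u * artanh u) * u - (1 - u\<^sup>2) * artanh u * 1
      = u - (1 + u\<^sup>2) * artanh u"
    by (simp add: algebra_simps power2_eq_square)
  moreover have "u \<le> (1 + u\<^sup>2) * artanh u"
  proof -
    have "1 * artanh u \<le> (1 + u\<^sup>2) * artanh u"
      using artanh_pos [OF u01] by (intro mult_right_mono) auto
    then show ?thesis using artanh_ge [of u] u01 by linarith
  qed
  ultimately show "\<exists>D. ((\<lambda>u. (1 - u\<^sup>2) * artanh u / u) has_real_derivative D) (at u) \<and> D \<le> 0"
    using u01 by (intro exI conjI) (auto intro!: divide_nonpos_nonneg)
qed

text \<open>The elasticity of the ratio is that of \<open>artanh\<close> at \<open>c * u\<close>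
  minus that at \<open>u\<close>. Since \<open>c * u \<le> u\<close>,
  \<open>artanh_quotient_decreasing\<close> makes it nonpositive.\<close>

lemma artanh_ratio_decreasing:
  assumes c: "0 < c" "c \<le> 1" and xy: "0 < x" "x \<le> y" "y < (1::real)"
  shows "artanh (c * y) / artanh y \<le> artanh (c * x) / artanh x"
proof (rule DERIV_nonpos_imp_nonincreasing [OF xy(2)])
  fix u assume u: "x \<le> u" "u \<le> y"
  with xy have u01: "0 < u" "u < 1" by auto
  have "c * u \<le> 1 * u" using c u01 by (intro mult_right_mono) auto
  then have cu: "0 < c * u" "c * u \<le> u" "c * u < 1"
    using mult_pos_pos [of c u] c u01 by linarith+
  have p: "0 < artanh u" "0 < artanh (c * u)" using u01 cu by (auto intro: artanh_pos)
  have sq: "0 < 1 - u\<^sup>2" "0 < 1 - (c * u)\<^sup>2"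
    using u01 cu by (simp_all add: power_less_one_iff abs_square_less_1)
  have "((\<lambda>u. artanh (c * u)) has_real_derivative 1 / (1 - (c * u)\<^sup>2) * c) (at u)"
    using cu by (intro DERIV_chain2 [where f = artanh] artanh_real_has_field_derivative)
      (auto intro!: derivative_eq_intros)
  moreover have "(artanh has_real_derivative 1 / (1 - u\<^sup>2)) (at u)"
    using u01 by (intro artanh_real_has_field_derivative) auto
  ultimately have "((\<lambda>u. artanh (c * u) / artanh u) has_real_derivative
      (1 / (1 - (c * u)\<^sup>2) * c * artanh u - artanh (c * u) * (1 / (1 - u\<^sup>2)))
        / (artanh u * artanh u)) (at u)"
    using p by (intro DERIV_divide) auto
  then have d: "((\<lambda>u. artanh (c * u) / artanh u) has_real_derivative
      (c * (1 / (1 - (c * u)\<^sup>2)) * artanh u - artanh (c * u) * (1 / (1 - u\<^sup>2)))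
        / (artanh u * artanh u)) (at u)"
    by (simp add: mult.commute)
  have "(1 - u\<^sup>2) * artanh u / u \<le> (1 - (c * u)\<^sup>2) * artanh (c * u) / (c * u)"
    using artanh_quotient_decreasing [of "c * u" u] cu u01 by simp
  then have "c * ((1 - u\<^sup>2) * artanh u) \<le> (1 - (c * u)\<^sup>2) * artanh (c * u)"
    using c u01 mult_right_mono [of "(1 - u\<^sup>2) * artanh u / u" _ "c * u"] by (fastforce simp: mult_ac)
  then have "c * (1 / (1 - (c * u)\<^sup>2)) * artanh u \<le> artanh (c * u) * (1 / (1 - u\<^sup>2))"
    using sq by (simp add: field_simps)
  then show "\<exists>D. ((\<lambda>u. artanh (c * u) / artanh u) has_real_derivative D) (at u) \<and> D \<le> 0"
    using d by (intro exI conjI) (auto intro!: divide_nonpos_nonneg)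
qed

text \<open>The graph of \<open>H2 (bstar q x)\<close> against \<open>H2 x\<close> is convex, as the slope of its tangent is
  \<open>c artanh (c u) / artanh u\<close> for \<open>u = 1 - 2 x\<close> and \<open>c = 1 - 2 q\<close>; this gives Mrs. Gerber's
  lemma in the form of its supporting lines.\<close>

lemma H2_bstar_supporting_line:
  assumes q: "0 \<le> q" "q < 1/2" and x0: "0 < x0" "x0 < 1/2"
  obtains lam where "0 < lam"
    "\<And>x. 0 \<le> x \<Longrightarrow> x \<le> 1 \<Longrightarrow> H2 (bstar q x0) - lam * H2 x0 \<le> H2 (bstar q x) - lam * H2 x"
proof -
  define c where "c = 1 - 2 * q"
  have c: "0 < c" "c \<le> 1" using q by (auto simp: c_def)
  \<comment> \<open>The slope of \<open>H2 (bstar q x)\<close> against \<open>H2 x\<close> at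
    \<open>x0\<close>, so that the derivative of \<open>F\<close> vanishes at
    \<open>x0\<close>.\<close>
  define lam where "lam = c * artanh (c * (1 - 2 * x0)) / artanh (1 - 2 * x0)"
  define F where "F = (\<lambda>x. H2 (bstar q x) - lam * H2 x)"
  have lam: "0 < lam"
  proof -
    define t where "t = 1 - 2 * x0"
    have t: "0 < t" "t < 1" using x0 by (auto simp: t_def)
    then have "c * t \<le> 1 * t" using c by (intro mult_right_mono) auto
    then have "c * t < 1" using t by linarith
    then show ?thesis
      unfolding lam_def t_def [symmetric]
      using c t by (intro divide_pos_pos mult_pos_pos artanh_pos) auto
  qed
  have cb: "1 - 2 * bstar q x = c * (1 - 2 * x)" for x
    by (simp add: c_def bstar_def algebra_simps)
  have d: "(F has_real_derivative (2 / ln 2) * (c * artanh (c * (1 - 2 * x)) - lam * artanh (1 - 2 * x))) (at x)"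
    if "0 < x" "x < 1/2" for x
  proof -
    have b: "0 < bstar q x" "bstar q x < 1"
      using bstar_ge [of q x] bstar_le_half [of q x] that q by auto
    have "(bstar q has_real_derivative c) (at x)"
      unfolding bstar_def by (auto intro!: derivative_eq_intros simp: c_def)
    then have "((\<lambda>x. H2 (bstar q x)) has_real_derivative
        ln ((1 - bstar q x) / bstar q x) / ln 2 * c) (at x)"
      by (rule DERIV_chain2 [where f = H2 and g = "bstar q" and x = x, OF H2_deriv [OF b]])
    then have "(F has_real_derivative ln ((1 - bstar q x) / bstar q x) / ln 2 * c
        - lam * (ln ((1 - x) / x) / ln 2)) (at x)"
      unfolding F_def using that by (intro DERIV_diff DERIV_cmult H2_deriv) auto
    moreover have "ln ((1 - bstar q x) / bstar q x) / ln 2 * c - lam * (ln ((1 - x) / x) / ln 2)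
        = (2 / ln 2) * (c * artanh (c * (1 - 2 * x)) - lam * artanh (1 - 2 * x))"
    proof -
      have "ln ((1 - bstar q x) / bstar q x) = 2 * artanh (c * (1 - 2 * x))"
        using ln_ratio_artanh [OF b] by (simp only: cb)
      moreover have "ln ((1 - x) / x) = 2 * artanh (1 - 2 * x)"
        using that by (intro ln_ratio_artanh) auto
      ultimately show ?thesis
        by (simp only:) (simp add: right_diff_distrib diff_divide_distrib mult_ac)
    qed
    ultimately show ?thesis by simp
  qed
  have slope: "c * artanh (c * (1 - 2 * x)) = c * (artanh (c * (1 - 2 * x)) / artanh (1 - 2 * x)) * artanh (1 - 2 * x)"
    "0 < artanh (1 - 2 * x)" if "0 < x" "x < 1/2" for x
    using artanh_pos [of "1 - 2 * x"] that by auto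
  have cont: "continuous_on {0..1} F"
    unfolding F_def using q by (intro continuous_intros bstar_nonneg bstar_le_1) auto
  have left: "F x0 \<le> F x" if "0 < x" "x \<le> x0" for x
  proof (rule DERIV_nonpos_imp_nonincreasing [OF that(2)])
    fix y assume y: "x \<le> y" "y \<le> x0"
    then have y': "0 < y" "y < 1/2" using that x0 by auto
    \<comment> \<open>To the left of \<open>x0\<close> the argument \<open>1 - 2 * y\<close> is
      larger, so the ratio of the two \<open>artanh\<close> values is at most its value at
      \<open>x0\<close>, which is contained in \<open>lam\<close>.\<close>
    have "c * artanh (c * (1 - 2 * y)) \<le> lam * artanh (1 - 2 * y)"
      unfolding slope(1) [OF y'] lam_def times_divide_eq_right [symmetric]
      using y y' x0 c slope(2) [OF y']
      by (intro mult_right_mono mult_left_mono artanh_ratio_decreasing) auto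
    then show "\<exists>D. (F has_real_derivative D) (at y) \<and> D \<le> 0"
      using d [OF y'] by (intro exI conjI) (auto simp: divide_le_0_iff)
  qed
  have right: "F x0 \<le> F x" if "x0 \<le> x" "x < 1/2" for x
  proof (rule DERIV_nonneg_imp_nondecreasing [OF that(1)])
    fix y assume y: "x0 \<le> y" "y \<le> x"
    then have y': "0 < y" "y < 1/2" using that x0 by auto
    have "lam * artanh (1 - 2 * y) \<le> c * artanh (c * (1 - 2 * y))"
      unfolding slope(1) [OF y'] lam_def times_divide_eq_right [symmetric]
      using y y' x0 c slope(2) [OF y']
      by (intro mult_right_mono mult_left_mono artanh_ratio_decreasing) auto
    then show "\<exists>D. (F has_real_derivative D) (at y) \<and> 0 \<le> D"
      using d [OF y'] by (intro exI conjI) (auto simp: zero_le_divide_iff)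
  qed
  have open_half: "F x0 \<le> F x" if "0 < x" "x < 1/2" for x
    using left [of x] right [of x] that by fastforce
  have half: "F x0 \<le> F x" if "0 \<le> x" "x \<le> 1/2" for x
  proof -
    \<comment> \<open>The derivative is controlled only in the open interval; continuity of
      \<open>F\<close> adds the endpoints.\<close>
    have "closure {0<..<1/2::real} \<subseteq> {x \<in> {0..1/2}. F x0 \<le> F x}"
    proof (rule closure_minimal)
      show "closed {x \<in> {0..1/2}. F x0 \<le> F x}"
        by (intro continuous_on_closed_Collect_le continuous_on_const continuous_on_subset [OF cont]) auto
    qed (use open_half in auto)
    then show ?thesis using that by auto
  qed
  have "F x0 \<le> F x" if "0 \<le> x" "x \<le> 1" for x
  proof (cases "x \<le> 1/2")
    case False
    have "F (1 - x) = F x"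
      by (simp add: F_def bstar_compl H2_sym)
    with half [of "1 - x"] False that show ?thesis by simp
  qed (use half that in simp)
  then show ?thesis
    using that [OF lam] unfolding F_def by blast
qed

text \<open>An unnormalized law of a bit is a multiple of a Bernoulli law. One \<open>x\<close>
  serves all \<open>q\<close>, so input and output entropy of the bit can be inserted into the same
  supporting line.\<close>

lemma Phi_bool_scale_H2:
  assumes "\<And>a. 0 \<le> u a"
  obtains x where "0 \<le> x" "x \<le> 1"
    "\<And>q. 0 \<le> q \<Longrightarrow> q \<le> 1 \<Longrightarrow> Phi UNIV (nb q u) = (u True + u False) * H2 (bstar q x)"
    "Phi UNIV u = (u True + u False) * H2 x"
proof (cases "u True + u False = 0")
  case True
  then have "u True = 0" "u False = 0" using assms [of True] assms [of False] by linarith+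
  then have "nb q u b = 0" "u b = 0" for q b
    by (cases b; simp add: nb_def UNIV_bool)+
  then show ?thesis using that [of 0] by (simp add: Phi_def)
next
  case False
  define s where "s = u True + u False"
  define x where "x = u True / s"
  have s: "0 < s" using False assms [of True] assms [of False] by (simp add: s_def)
  have x: "0 \<le> x" "x \<le> 1" using s assms [of True] assms [of False] by (auto simp: x_def s_def)
  have u: "u = (\<lambda>a. s * bk x False a)"
  proof
    fix a
    have "s * x = u True" using s by (simp add: x_def)
    then show "u a = s * bk x False a"
      by (cases a) (auto simp: bk_def s_def right_diff_distrib)
  qed
  have nb: "nb q u = (\<lambda>b. s * bk (bstar q x) False b)" for q
    by (rule ext, subst u) (auto simp: nb_def bk_def bstar_def UNIV_bool algebra_simps)
  have "Phi UNIV (nb q u) = s * H2 (bstar q x)" if "0 \<le> q" "q \<le> 1" for q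
    unfolding nb using s x that
    by (subst Phi_scale) (auto intro!: bk_nonneg bstar_nonneg bstar_le_1 simp: Phi_bk)
  moreover have "Phi UNIV u = s * H2 x"
    by (subst u, subst Phi_scale) (use s x in \<open>auto intro!: bk_nonneg simp: Phi_bk\<close>)
  ultimately show ?thesis using that x by (simp add: s_def)
qed

text \<open>Linearity lets the single-letter line tensorize: the chain rule splits off the last bit,
  whose conditional laws obey the line one by one, and \<open>Phi_nz_Suc\<close> recombines the
  pieces on the noisy side.\<close>

lemma Phi_nz_supporting_line:
  assumes q: "0 \<le> q" "q \<le> 1" and lam: "0 \<le> lam"
    and line: "\<And>x. 0 \<le> x \<Longrightarrow> x \<le> 1 \<Longrightarrow> C \<le> H2 (bstar q x) - lam * H2 x"
    and v: "\<And>y. y \<in> seqs l \<Longrightarrow> 0 \<le> v y"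
  shows "real l * C * (\<Sum>y\<in>seqs l. v y) \<le> Phi (seqs l) (nz q l v) - lam * Phi (seqs l) v"
  using v
proof (induction l arbitrary: v)
  case 0
  then show ?case by (simp add: nz_def Phi_def seqs_0 ker_def)
next
  case (Suc l)
  let ?v = "\<lambda>y. \<Sum>b\<in>UNIV. v (y(l := b))"
  have v': "0 \<le> v (y(l := b))" if "y \<in> seqs l" for y b
    using that Suc.prems seqs_upd by blast
  have "real l * C * (\<Sum>y\<in>seqs l. ?v y) \<le> Phi (seqs l) (nz q l ?v) - lam * Phi (seqs l) ?v"
    by (rule Suc.IH) (intro sum_nonneg v')
  moreover have "(\<Sum>y\<in>seqs l. C * ?v y)
      \<le> (\<Sum>y\<in>seqs l. Phi UNIV (nb q (\<lambda>b. v (y(l := b)))) - lam * Phi UNIV (\<lambda>b. v (y(l := b))))"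
  proof (rule sum_mono)
    fix y assume y: "y \<in> seqs l"
    obtain x where x: "0 \<le> x" "x \<le> 1" 
      and 1: "Phi UNIV (nb q (\<lambda>b. v (y(l := b)))) = (v (y(l := True)) + v (y(l := False))) * H2 (bstar q x)"
      and 2: "Phi UNIV (\<lambda>b. v (y(l := b))) = (v (y(l := True)) + v (y(l := False))) * H2 x"
      using Phi_bool_scale_H2 [of "\<lambda>b. v (y(l := b))"] v' [OF y] q by metis
    have "(v (y(l := True)) + v (y(l := False))) * C
        \<le> (v (y(l := True)) + v (y(l := False))) * (H2 (bstar q x) - lam * H2 x)"
      using line [OF x] v' [OF y] by (intro mult_left_mono) auto
    then show "C * ?v y \<le> Phi UNIV (nb q (\<lambda>b. v (y(l := b)))) - lam * Phi UNIV (\<lambda>b. v (y(l := b)))"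
      unfolding 1 2 by (simp add: UNIV_bool algebra_simps)
  qed
  moreover note Phi_nz_Suc [of q l v, OF q Suc.prems]
  ultimately show ?case
    by (simp add: Phi_seqs_Suc [of l v] sum_subtractf sum_distrib_left [symmetric] sum_seqs_Suc algebra_simps)
qed

lemma Phi_seqs_le:
  assumes "\<And>y. y \<in> seqs l \<Longrightarrow> 0 \<le> v y"
  shows "Phi (seqs l) v \<le> real l * (\<Sum>y\<in>seqs l. v y)"
  using assms
proof (induction l arbitrary: v)
  case 0
  then show ?case by (simp add: Phi_def seqs_0)
next
  case (Suc l)
  let ?v = "\<lambda>y. \<Sum>b\<in>UNIV. v (y(l := b))"
  have v': "0 \<le> v (y(l := b))" if "y \<in> seqs l" for y b
    using that Suc.prems seqs_upd by blast
  have "Phi (seqs l) ?v \<le> real l * (\<Sum>y\<in>seqs l. ?v y)"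
    by (rule Suc.IH) (intro sum_nonneg v')
  moreover have "Phi UNIV (\<lambda>b. v (y(l := b))) \<le> ?v y" if "y \<in> seqs l" for y
  proof -
    let ?u = "\<lambda>b. v (y(l := b))"
    let ?s = "?u True + ?u False"
    \<comment> \<open>The law plus its flip is uniform with twice the mass, and both summands have
      the same entropy.\<close>
    have "Phi UNIV ?u + Phi UNIV (\<lambda>b. ?u (\<not> b)) \<le> Phi UNIV (\<lambda>b. ?u b + ?u (\<not> b))"
      using v' [OF that] by (intro Phi_add) auto
    moreover have "Phi UNIV (\<lambda>b. ?u (\<not> b)) = Phi UNIV ?u"
      by (simp add: Phi_def UNIV_bool add.commute)
    moreover have "Phi UNIV (\<lambda>b. ?u b + ?u (\<not> b)) = 2 * ?s"
    proof -
      have "Phi UNIV (\<lambda>b. ?u b + ?u (\<not> b)) = Phi UNIV (\<lambda>b. (2 * ?s) * bk (1/2) False b)"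
        by (rule Phi_cong) (auto simp: bk_def)
      also have "\<dots> = 2 * ?s"
        using v' [OF that] by (subst Phi_scale) (auto simp: Phi_bk H2_half intro!: bk_nonneg)
      finally show ?thesis .
    qed
    ultimately show ?thesis by (simp add: UNIV_bool add.commute)
  qed
  then have "(\<Sum>y\<in>seqs l. Phi UNIV (\<lambda>b. v (y(l := b)))) \<le> (\<Sum>y\<in>seqs l. ?v y)"
    by (rule sum_mono)
  ultimately show ?case
    by (simp add: Phi_seqs_Suc sum_seqs_Suc algebra_simps)
qed

text \<open>Data processing: splitting each law \<open>w c\<close> by the stochastic weights
  \<open>k c c'\<close> and regrouping by \<open>c'\<close> reduces the claim to superadditivity of
  \<open>Phi\<close>. Conditioning on a noisier variable leaves more entropy.\<close>

lemma Phi_degrade: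
  assumes "finite A" "finite C" "finite C'"
    and "\<And>c c'. c \<in> C \<Longrightarrow> c' \<in> C' \<Longrightarrow> 0 \<le> k c c'" "\<And>c. c \<in> C \<Longrightarrow> (\<Sum>c'\<in>C'. k c c') = 1"
    and "\<And>c x. c \<in> C \<Longrightarrow> x \<in> A \<Longrightarrow> 0 \<le> w c x"
  shows "(\<Sum>c\<in>C. Phi A (w c)) \<le> (\<Sum>c'\<in>C'. Phi A (\<lambda>x. \<Sum>c\<in>C. k c c' * w c x))"
proof -
  have "(\<Sum>c\<in>C. Phi A (w c)) = (\<Sum>c\<in>C. (\<Sum>c'\<in>C'. k c c') * Phi A (w c))"
    using assms by simp
  also have "\<dots> = (\<Sum>c'\<in>C'. \<Sum>c\<in>C. k c c' * Phi A (w c))"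
    by (subst sum.swap) (simp only: sum_distrib_right)
  also have "\<dots> = (\<Sum>c'\<in>C'. \<Sum>c\<in>C. Phi A (\<lambda>x. k c c' * w c x))"
    using assms by (intro sum.cong refl Phi_scale [symmetric]) auto
  also have "\<dots> \<le> (\<Sum>c'\<in>C'. Phi A (\<lambda>x. \<Sum>c\<in>C. k c c' * w c x))"
    using assms by (intro sum_mono Phi_sum) auto
  finally show ?thesis .
qed

section \<open>The source converse\<close>

text \<open>The properties of \<open>equivocation_gap\<close> on which the guessing argument relies.
  Quantifying over all such functionals keeps \<open>\<alpha>\<close> free of \<open>\<tau>\<close>
  and \<open>\<delta>\<close>.\<close>

definition sublinear_symmetric :: "((bool \<Rightarrow> real) \<Rightarrow> real) \<Rightarrow> bool" where
  "sublinear_symmetric R \<longleftrightarrow>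
     (\<forall>u v. (\<forall>a. 0 \<le> u a) \<longrightarrow> (\<forall>a. 0 \<le> v a) \<longrightarrow> R (\<lambda>a. u a + v a) \<le> R u + R v) \<and>
     (\<forall>c u. 0 \<le> c \<longrightarrow> (\<forall>a. 0 \<le> u a) \<longrightarrow> R (\<lambda>a. c * u a) = c * R u) \<and>
     (\<forall>u. R (\<lambda>a. u (\<not> a)) = R u)"

lemma
  assumes "sublinear_symmetric R"
  shows sublinear_symmetric_add:
      "\<lbrakk>\<And>a. 0 \<le> u a; \<And>a. 0 \<le> v a\<rbrakk> \<Longrightarrow> R (\<lambda>a. u a + v a) \<le> R u + R v"
    and sublinear_symmetric_scale:
      "\<lbrakk>0 \<le> c; \<And>a. 0 \<le> u a\<rbrakk> \<Longrightarrow> R (\<lambda>a. c * u a) = c * R u"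
    and sublinear_symmetric_not: "R (\<lambda>a. u (\<not> a)) = R u"
  using assms by (auto simp: sublinear_symmetric_def)

lemma sublinear_symmetric_sum:
  assumes R: "sublinear_symmetric R" and "finite J" "\<And>j a. j \<in> J \<Longrightarrow> 0 \<le> u j a"
  shows "R (\<lambda>a. \<Sum>j\<in>J. u j a) \<le> (\<Sum>j\<in>J. R (u j))"
  using assms(2,3)
proof (induction J)
  case empty
  show ?case using sublinear_symmetric_scale [OF R, of 0 "\<lambda>_. 0"] by simp
next
  case (insert j J)
  have "R (\<lambda>a. u j a + (\<Sum>j\<in>J. u j a)) \<le> R (u j) + R (\<lambda>a. \<Sum>j\<in>J. u j a)"
    using insert.prems by (intro sublinear_symmetric_add [OF R]) (auto intro: sum_nonneg)
  then show ?case using insert by force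
qed

text \<open>Symmetrization: \<open>u\<close> plus its flip is a uniform law with twice the mass, and
  \<open>R\<close> takes the same value on both summands.\<close>

lemma sublinear_symmetric_ge:
  assumes R: "sublinear_symmetric R" and u: "\<And>a. 0 \<le> u a"
  shows "(u True + u False) * R (bk (1/2) False) \<le> R u"
proof -
  have "R (\<lambda>a. u a + u (\<not> a)) \<le> R u + R (\<lambda>a. u (\<not> a))"
    by (rule sublinear_symmetric_add [OF R]) (auto simp: u)
  also have "R (\<lambda>a. u (\<not> a)) = R u" by (rule sublinear_symmetric_not [OF R])
  also have "(\<lambda>a. u a + u (\<not> a)) = (\<lambda>a. 2 * (u True + u False) * bk (1/2) False a)"
    by (auto simp: bk_def fun_eq_iff all_bool_eq)
  also have "R \<dots> = 2 * (u True + u False) * R (bk (1/2) False)"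
    using u by (intro sublinear_symmetric_scale [OF R]) (auto simp: bk_def)
  finally show ?thesis by (simp add: algebra_simps)
qed

text \<open>Given everything but the side-information bit \<open>c\<close>, the guess either ignores \<open>c\<close>, or
  has error probability at least \<open>\<beta>\<close>. Only guesses of the first kind reveal anything beyond the
  side information, and \<open>\<alpha>\<close> is their error rate.\<close>

lemma guess_tradeoff:
  fixes I :: "'i set"
  assumes I: "finite I" and w: "\<And>i a. i \<in> I \<Longrightarrow> 0 \<le> w i a"
    and m: "0 < m" "(\<Sum>i\<in>I. w i True + w i False) = m"
    and \<beta>: "0 \<le> \<beta>" "\<beta> \<le> 1/2"
    and d: "m * d = (\<Sum>i\<in>I. \<Sum>c\<in>UNIV. \<Sum>a\<in>UNIV. w i a * bk \<beta> a c * (if h i c \<noteq> a then 1 else 0))"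
  obtains \<alpha> where "0 \<le> \<alpha>" "\<alpha> \<le> d" "\<alpha> \<le> \<beta>"
    "\<And>R. sublinear_symmetric R \<Longrightarrow>
      m * (eta \<alpha> \<beta> (min d \<beta>) * (R (bk \<alpha> False) - R (bk (1/2) False)))
      \<le> (\<Sum>i\<in>I. R (w i)) - m * R (bk (1/2) False)"
proof -
  define A where "A = {i \<in> I. h i True = h i False}"
  define B where "B = {i \<in> I. h i True \<noteq> h i False}"
  \<comment> \<open>The bit is relabelled by whether it differs from the guess, so that
    \<open>v i True\<close> is the mass of the error event whatever the guess is.\<close>
  define v where "v = (\<lambda>i a. w i (h i True \<noteq> a))"
  have AB: "I = A \<union> B" "A \<inter> B = {}" "finite A" "finite B"
    using I by (auto simp: A_def B_def)
  have sumI: "(\<Sum>i\<in>I. F i) = (\<Sum>i\<in>A. F i) + (\<Sum>i\<in>B. F i)" for F :: "_ \<Rightarrow> real"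
    unfolding AB(1) using AB by (intro sum.union_disjoint)
  have v0: "0 \<le> v i a" if "i \<in> A" for i a
    using that w by (auto simp: v_def A_def)
  define Err where "Err = (\<Sum>i\<in>A. v i True)"
  define M where "M = (\<Sum>i\<in>A. w i True + w i False)"
  have MB: "(\<Sum>i\<in>B. w i True + w i False) = m - M"
    using m(2) by (simp add: sumI M_def)
  have M_v: "M = (\<Sum>i\<in>A. v i True + v i False)"
    unfolding M_def
  proof (intro sum.cong refl)
    fix i show "w i True + w i False = v i True + v i False"
      by (cases "h i True") (auto simp: v_def)
  qed
  have Err: "0 \<le> Err" "Err \<le> M"
    unfolding Err_def M_v using v0 by (auto intro!: sum_nonneg sum_mono)
  have MB0: "0 \<le> m - M"
    unfolding MB [symmetric] by (intro sum_nonneg) (use w in \<open>auto simp: B_def intro!: add_nonneg_nonneg\<close>)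
  have d_ge: "Err + (m - M) * \<beta> \<le> m * d"
  proof -
    let ?e = "\<lambda>i. \<Sum>c\<in>UNIV. \<Sum>a\<in>UNIV. w i a * bk \<beta> a c * (if h i c \<noteq> a then 1 else 0)"
    have "v i True = ?e i" if "i \<in> A" for i
      using that by (cases "h i True") (auto simp: v_def A_def UNIV_bool bk_def algebra_simps)
    \<comment> \<open>Here the guess is \<open>c\<close> or its negation, so it is wrong with
      probability \<open>\<beta>\<close> or \<open>1 - \<beta>\<close>, and
      \<open>\<beta> \<le> 1/2\<close>.\<close>
    moreover have "(w i True + w i False) * \<beta> \<le> ?e i" if "i \<in> B" for i
    proof -
      have w0: "0 \<le> w i True" "0 \<le> w i False" using that w by (auto simp: B_def)
      have "w i a * \<beta> \<le> w i a * (1 - \<beta>)" for a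
        using w0 \<beta> by (cases a) (auto intro: mult_left_mono)
      from this [of True] this [of False] show ?thesis
        using that by (cases "h i True") (auto simp: B_def UNIV_bool bk_def algebra_simps)
    qed
    ultimately show ?thesis
      unfolding d sumI Err_def MB [symmetric] sum_distrib_right
      by (intro add_mono sum_mono) auto
  qed
  show ?thesis
  \<comment> \<open>Otherwise the guesses that ignore \<open>c\<close> err with rate at least
    \<open>\<beta>\<close>, or have no mass. Then \<open>d\<close> is at least
    \<open>\<beta>\<close>, and for \<open>\<alpha> = \<beta>\<close> the factor \<open>eta\<close>
    is 0, so the lower bound by uniform laws suffices.\<close>
  proof (cases "Err < M * \<beta>")
    case True
    then have "0 < M * \<beta>" using Err by linarith
    then have M: "0 < M" using \<beta> by (simp add: zero_less_mult_iff)
    define \<alpha> where "\<alpha> = Err / M"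
    have \<alpha>M: "Err = M * \<alpha>" using M by (simp add: \<alpha>_def)
    have \<alpha>: "0 \<le> \<alpha>" "\<alpha> < \<beta>" using True Err M by (auto simp: \<alpha>_def field_simps)
    have "m * \<alpha> \<le> Err + (m - M) * \<beta>"
      using mult_left_mono [of \<alpha> \<beta> "m - M"] \<alpha> MB0 by (simp add: \<alpha>M algebra_simps)
    then have "m * \<alpha> \<le> m * d" using d_ge by linarith
    then have \<alpha>d: "\<alpha> \<le> d" using m by simp
    \<comment> \<open>The origin of \<open>eta\<close>: \<open>d_ge\<close> bounds
      \<open>m * d\<close> below by \<open>M * \<alpha> + (m - M) * \<beta>\<close>, and solving for
      \<open>M / m\<close> gives this fraction.\<close>
    have eta: "m * eta \<alpha> \<beta> (min d \<beta>) \<le> M"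
    proof (cases "d < \<beta>")
      case True
      have "m * (\<beta> - d) \<le> M * (\<beta> - \<alpha>)" using d_ge by (simp add: \<alpha>M algebra_simps)
      then show ?thesis using True \<alpha> by (simp add: eta_def field_simps)
    next
      case False
      then show ?thesis using M by (simp add: eta_def)
    qed
    show ?thesis
    proof (rule that [of \<alpha>])
      fix R assume R: "sublinear_symmetric R"
      let ?r = "R (bk (1/2) False)"
      have psi: "?r \<le> R (bk \<alpha> False)"
        using sublinear_symmetric_ge [OF R, of "bk \<alpha> False"] \<alpha> \<beta> by (auto simp: bk_def)
      have "M * R (bk \<alpha> False) = R (\<lambda>a. M * bk \<alpha> False a)"
        using M \<alpha> \<beta> by (intro sublinear_symmetric_scale [OF R, symmetric]) (auto simp: bk_def)
      \<comment> \<open>After the relabelling the laws can be added without mixing errors and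
        correct guesses: the sum has mass \<open>M\<close> and error share
        \<open>\<alpha>\<close>.\<close>
      also have "(\<lambda>a. M * bk \<alpha> False a) = (\<lambda>a. \<Sum>i\<in>A. v i a)"
      proof
        fix a show "M * bk \<alpha> False a = (\<Sum>i\<in>A. v i a)"
          using \<alpha>M M_v
          by (cases a) (auto simp: bk_def right_diff_distrib Err_def sum.distrib)
      qed
      also have "R \<dots> \<le> (\<Sum>i\<in>A. R (v i))"
        using AB v0 by (intro sublinear_symmetric_sum [OF R]) auto
      also have "\<dots> = (\<Sum>i\<in>A. R (w i))"
      proof (intro sum.cong refl)
        fix i
        show "R (v i) = R (w i)"
          using sublinear_symmetric_not [OF R, of "w i"] by (cases "h i True") (auto simp: v_def)
      qed
      finally have 1: "M * R (bk \<alpha> False) \<le> (\<Sum>i\<in>A. R (w i))" .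
      have 2: "(m - M) * ?r \<le> (\<Sum>i\<in>B. R (w i))"
        unfolding MB [symmetric] sum_distrib_right
        by (intro sum_mono sublinear_symmetric_ge [OF R]) (auto simp: B_def w)
      have "m * eta \<alpha> \<beta> (min d \<beta>) * (R (bk \<alpha> False) - ?r) \<le> M * (R (bk \<alpha> False) - ?r)"
        using eta psi by (intro mult_right_mono) auto
      then show "m * (eta \<alpha> \<beta> (min d \<beta>) * (R (bk \<alpha> False) - ?r)) \<le> (\<Sum>i\<in>I. R (w i)) - m * ?r"
        using 1 2 by (simp add: sumI algebra_simps)
    qed (use \<alpha> \<alpha>d in auto)
  next
    case False
    then have "m * \<beta> \<le> m * d" using d_ge by (simp add: algebra_simps)
    then have "\<beta> \<le> d" using m by simp
    show ?thesis
    proof (rule that [of \<beta>])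
      fix R assume R: "sublinear_symmetric R"
      have "m * R (bk (1/2) False) \<le> (\<Sum>i\<in>I. R (w i))"
        unfolding m(2) [symmetric] sum_distrib_right
        by (intro sum_mono sublinear_symmetric_ge [OF R]) (auto simp: w)
      then show "m * (eta \<beta> \<beta> (min d \<beta>) * (R (bk \<beta> False) - R (bk (1/2) False)))
          \<le> (\<Sum>i\<in>I. R (w i)) - m * R (bk (1/2) False)"
        by (simp add: eta_def)
    qed (use \<beta> \<open>\<beta> \<le> d\<close> in auto)
  qed
qed

text \<open>For a bit with law \<open>w\<close>: how much more is unknown, given its side information \<open>c\<close>, about its
  \<open>bstar \<tau> \<delta>\<close>-noisy copy than about the \<open>\<tau>\<close>-noisy copy.\<close>

definition equivocation_gap :: "real \<Rightarrow> real \<Rightarrow> real \<Rightarrow> (bool \<Rightarrow> real) \<Rightarrow> real" where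
  "equivocation_gap \<beta> \<tau> \<delta> w = (\<Sum>c\<in>UNIV. rho \<delta> (nb \<tau> (\<lambda>a. bk \<beta> a c * w a)))"

lemma rho_scale:
  assumes "0 \<le> q" "q \<le> 1" "0 \<le> c" "\<And>a. 0 \<le> u a"
  shows "rho q (\<lambda>a. c * u a) = c * rho q u"
proof -
  have "nb q (\<lambda>a. c * u a) = (\<lambda>b. c * nb q u b)"
    by (auto simp: nb_def UNIV_bool algebra_simps)
  then show ?thesis
    using assms by (simp add: rho_def Phi_scale nb_nonneg right_diff_distrib)
qed

text \<open>Subadditivity and homogeneity come from \<open>rho\<close> for each value of
  \<open>c\<close>; flip invariance holds because source bit, side information and noisy copy can be
  flipped together.\<close>

lemma equivocation_gap_sublinear:
  assumes "0 \<le> \<beta>" "\<beta> \<le> 1" "0 \<le> \<tau>" "\<tau> \<le> 1" "0 \<le> \<delta>" "\<delta> \<le> 1"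
  shows "sublinear_symmetric (equivocation_gap \<beta> \<tau> \<delta>)"
  unfolding sublinear_symmetric_def
proof (intro conjI allI impI)
  fix u v :: "bool \<Rightarrow> real" assume u: "\<forall>a. 0 \<le> u a" "\<forall>a. 0 \<le> v a"
  have "rho \<delta> (nb \<tau> (\<lambda>a. bk \<beta> a c * (u a + v a)))
      \<le> rho \<delta> (nb \<tau> (\<lambda>a. bk \<beta> a c * u a)) + rho \<delta> (nb \<tau> (\<lambda>a. bk \<beta> a c * v a))" for c
  proof -
    \<comment> \<open>The two summands are indexed by a Boolean so that \<open>rho_sum\<close>
      applies.\<close>
    let ?f = "\<lambda>j. nb \<tau> (\<lambda>a. bk \<beta> a c * (if j then u a else v a))"
    have "rho \<delta> (\<lambda>b. \<Sum>j\<in>UNIV. ?f j b) \<le> (\<Sum>j\<in>UNIV. rho \<delta> (?f j))"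
      using assms u by (intro rho_sum) (auto intro!: nb_nonneg mult_nonneg_nonneg bk_nonneg)
    moreover have "(\<lambda>b. \<Sum>j\<in>UNIV. ?f j b) = nb \<tau> (\<lambda>a. bk \<beta> a c * (u a + v a))"
      by (rule ext) (simp add: nb_def UNIV_bool algebra_simps)
    ultimately show ?thesis by (simp add: UNIV_bool add.commute)
  qed
  then show "equivocation_gap \<beta> \<tau> \<delta> (\<lambda>a. u a + v a) \<le> equivocation_gap \<beta> \<tau> \<delta> u + equivocation_gap \<beta> \<tau> \<delta> v"
    by (simp add: equivocation_gap_def sum.distrib [symmetric] sum_mono del: sum.distrib)
next
  fix c :: real and u :: "bool \<Rightarrow> real" assume c: "0 \<le> c" and u: "\<forall>a. 0 \<le> u a"
  have "nb \<tau> (\<lambda>a. bk \<beta> a e * (c * u a)) = (\<lambda>b. c * nb \<tau> (\<lambda>a. bk \<beta> a e * u a) b)" for e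
    by (rule ext) (simp add: nb_def UNIV_bool algebra_simps)
  moreover have "rho \<delta> (\<lambda>b. c * nb \<tau> (\<lambda>a. bk \<beta> a e * u a) b) = c * rho \<delta> (nb \<tau> (\<lambda>a. bk \<beta> a e * u a))" for e
    using assms c u by (intro rho_scale) (auto intro!: nb_nonneg mult_nonneg_nonneg bk_nonneg)
  ultimately show "equivocation_gap \<beta> \<tau> \<delta> (\<lambda>a. c * u a) = c * equivocation_gap \<beta> \<tau> \<delta> u"
    by (simp add: equivocation_gap_def sum_distrib_left)
next
  fix u :: "bool \<Rightarrow> real"
  have n: "nb \<tau> (\<lambda>a. bk \<beta> a c * u (\<not> a)) = (\<lambda>b. nb \<tau> (\<lambda>a. bk \<beta> a (\<not> c) * u a) (\<not> b))"
    for \<tau> c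
    by (rule ext) (auto simp: nb_def UNIV_bool bk_def)
  have P: "Phi UNIV (\<lambda>b. f (\<not> b)) = Phi UNIV f" for f :: "bool \<Rightarrow> real"
    by (simp add: Phi_def UNIV_bool add.commute)
  have "rho \<delta> (nb \<tau> (\<lambda>a. bk \<beta> a c * u (\<not> a))) = rho \<delta> (nb \<tau> (\<lambda>a. bk \<beta> a (\<not> c) * u a))" for c
    by (simp only: rho_nb) (simp only: n P)
  then show "equivocation_gap \<beta> \<tau> \<delta> (\<lambda>a. u (\<not> a)) = equivocation_gap \<beta> \<tau> \<delta> u"
    by (simp add: equivocation_gap_def UNIV_bool add.commute)
qed

text \<open>Noise preserves mass, so the correction terms in \<open>Phi\<close> cancel and a
  difference of joint entropies of side information and noisy copy remains.\<close>

lemma equivocation_gap_eq: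
  "equivocation_gap \<beta> \<tau> \<delta> w = (\<Sum>c\<in>UNIV. \<Sum>b\<in>UNIV. nlog (nb (bstar \<tau> \<delta>) (\<lambda>a. bk \<beta> a c * w a) b))
    - (\<Sum>c\<in>UNIV. \<Sum>b\<in>UNIV. nlog (nb \<tau> (\<lambda>a. bk \<beta> a c * w a) b))"
proof -
  have "(\<Sum>b\<in>UNIV. nb q u b) = (\<Sum>a\<in>UNIV. u a)" for q u
    by (simp add: nb_def UNIV_bool bk_def algebra_simps)
  then show ?thesis by (simp add: equivocation_gap_def rho_nb Phi_def sum_subtractf)
qed

text \<open>This identifies \<open>H4\<close>: the joint entropy of the \<open>\<beta>\<close>-noisy
  and the \<open>\<tau>\<close>-noisy copy of a bit that is Bernoulli with parameter
  \<open>\<alpha>\<close>.\<close>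

lemma H4_eq: "(\<Sum>c\<in>UNIV. \<Sum>b\<in>UNIV. nlog (nb \<tau> (\<lambda>a. bk \<beta> a c * bk \<alpha> False a) b)) = H4 \<alpha> \<beta> \<tau>"
  by (simp add: nb_def UNIV_bool bk_def H4_def algebra_simps)

lemma equivocation_gap_bk: "equivocation_gap \<beta> \<tau> \<delta> (bk \<alpha> False) = H4 \<alpha> \<beta> (bstar \<tau> \<delta>) - H4 \<alpha> \<beta> \<tau>"
  by (simp only: equivocation_gap_eq H4_eq)

text \<open>For a uniform bit one of the two noisy copies is uniform, and the other is obtained from
  it with crossover \<open>bstar \<beta> \<tau>\<close>.\<close>

lemma H4_half:
  assumes "0 \<le> \<beta>" "\<beta> \<le> 1" "0 \<le> \<tau>" "\<tau> \<le> 1"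
  shows "H4 (1/2) \<beta> \<tau> = H2 (bstar \<beta> \<tau>) + 1"
proof -
  let ?x = "bstar \<beta> \<tau>"
  have h: "nlog ((1/2) * y) = (1/2) * nlog y + y * (1/2)" if "0 \<le> y" for y
    using that by (subst nlog_mult) (auto simp: nlog_def log_divide)
  have "H4 (1/2) \<beta> \<tau> = 2 * nlog ((1/2) * (1 - ?x)) + 2 * nlog ((1/2) * ?x)"
    by (simp add: H4_def bstar_def algebra_simps add_divide_distrib diff_divide_distrib)
  also have "\<dots> = H2 ?x + 1"
    using assms bstar_le_1 [of \<beta> \<tau>] h [of ?x] h [of "1 - ?x"]
    by (simp add: bstar_nonneg H2_nlog diff_divide_distrib)
  finally show ?thesis .
qed

text \<open>The joint law of the channel output \<open>y\<close>, the side information \<open>z\<close> and a remote source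
  \<open>v\<close> that is the source seen through a binary symmetric channel with crossover \<open>\<tau>\<close>.\<close>

definition joint :: "real \<Rightarrow> real \<Rightarrow> real \<Rightarrow> nat \<Rightarrow> nat \<Rightarrow> ((nat \<Rightarrow> bool) \<Rightarrow> nat \<Rightarrow> bool)
    \<Rightarrow> (nat \<Rightarrow> bool) \<Rightarrow> (nat \<Rightarrow> bool) \<Rightarrow> (nat \<Rightarrow> bool) \<Rightarrow> real" where
  "joint q \<beta> \<tau> m n f y z v =
    (\<Sum>s\<in>seqs m. (1/2) ^ m * ker \<beta> m s z * ker \<tau> m s v * ker q n (f s) y)"

text \<open>With \<open>q = p k\<close> and \<open>\<beta> = \<beta> k\<close> this is the
  \<open>E k \<tau>\<close> of the overview: the entropy of the channel output given side
  information and remote source.\<close>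

definition cond_ent :: "real \<Rightarrow> real \<Rightarrow> real \<Rightarrow> nat \<Rightarrow> nat \<Rightarrow> ((nat \<Rightarrow> bool) \<Rightarrow> nat \<Rightarrow> bool) \<Rightarrow> real" where
  "cond_ent q \<beta> \<tau> m n f = (\<Sum>z\<in>seqs m. \<Sum>v\<in>seqs m. Phi (seqs n) (\<lambda>y. joint q \<beta> \<tau> m n f y z v))"

section \<open>Marginals and degradations of the joint law\<close>

lemma joint_nonneg:
  "0 \<le> q \<Longrightarrow> q \<le> 1 \<Longrightarrow> 0 \<le> \<beta> \<Longrightarrow> \<beta> \<le> 1 \<Longrightarrow> 0 \<le> \<tau> \<Longrightarrow> \<tau> \<le> 1 \<Longrightarrow> 0 \<le> joint q \<beta> \<tau> m n f y z v"
  unfolding joint_def by (intro sum_nonneg mult_nonneg_nonneg ker_nonneg) auto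

lemma nz_joint_y: "nz r n (\<lambda>y. joint q \<beta> \<tau> m n f y z v) y = joint (bstar q r) \<beta> \<tau> m n f y z v"
proof -
  have "nz r n (\<lambda>y. joint q \<beta> \<tau> m n f y z v) y
      = (\<Sum>s\<in>seqs m. (1/2) ^ m * ker \<beta> m s z * ker \<tau> m s v *
          (\<Sum>x\<in>seqs n. ker q n (f s) x * ker r n x y))"
    unfolding nz_def joint_def sum_distrib_left by (subst sum.swap) (simp add: mult_ac)
  then show ?thesis by (simp add: ker_comp joint_def)
qed

lemma nz_joint_v: "nz r m (\<lambda>v. joint q \<beta> \<tau> m n f y z v) v = joint q \<beta> (bstar \<tau> r) m n f y z v"
proof -
  have "nz r m (\<lambda>v. joint q \<beta> \<tau> m n f y z v) v
      = (\<Sum>s\<in>seqs m. (1/2) ^ m * ker \<beta> m s z * (\<Sum>x\<in>seqs m. ker \<tau> m s x * ker r m x v) *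
          ker q n (f s) y)"
    unfolding nz_def joint_def sum_distrib_left sum_distrib_right
    by (subst sum.swap) (simp add: mult_ac)
  then show ?thesis by (simp add: ker_comp joint_def)
qed

lemma nz_joint_z: "nz r m (\<lambda>z. joint q \<beta> \<tau> m n f y z v) z = joint q (bstar \<beta> r) \<tau> m n f y z v"
proof -
  have "nz r m (\<lambda>z. joint q \<beta> \<tau> m n f y z v) z
      = (\<Sum>s\<in>seqs m. (1/2) ^ m * (\<Sum>x\<in>seqs m. ker \<beta> m s x * ker r m x z) * ker \<tau> m s v *
          ker q n (f s) y)"
    unfolding nz_def joint_def sum_distrib_left sum_distrib_right
    by (subst sum.swap) (simp add: mult_ac)
  then show ?thesis by (simp add: ker_comp joint_def)
qed

text \<open>Without the channel output the code drops out: \<open>z\<close> is uniform and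
  \<open>v\<close> is its copy with crossover \<open>bstar \<beta> \<tau>\<close>.\<close>

lemma sum_joint_y: "(\<Sum>y\<in>seqs n. joint q \<beta> \<tau> m n f y z v) = (1/2) ^ m * ker (bstar \<beta> \<tau>) m z v"
proof -
  have "(\<Sum>y\<in>seqs n. joint q \<beta> \<tau> m n f y z v)
      = (\<Sum>s\<in>seqs m. (1/2) ^ m * ker \<beta> m s z * ker \<tau> m s v * (\<Sum>y\<in>seqs n. ker q n (f s) y))"
    unfolding joint_def sum_distrib_left by (rule sum.swap)
  also have "\<dots> = (1/2) ^ m * (\<Sum>s\<in>seqs m. ker \<beta> m z s * ker \<tau> m s v)"
    by (simp add: ker_sym [of \<beta> m _ z] sum_distrib_left mult.assoc)
  finally show ?thesis by (simp add: ker_comp)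
qed

lemma sum_half_pow: "(\<Sum>s\<in>seqs m. (1/2) ^ m) = (1::real)"
  by (simp add: card_seqs power_one_over)

lemma cond_ent_le:
  assumes "0 \<le> q" "q \<le> 1" "0 \<le> \<beta>" "\<beta> \<le> 1" "0 \<le> \<tau>" "\<tau> \<le> 1"
  shows "cond_ent q \<beta> \<tau> m n f \<le> real n"
proof -
  have "cond_ent q \<beta> \<tau> m n f
      \<le> (\<Sum>z\<in>seqs m. \<Sum>v\<in>seqs m. real n * (\<Sum>y\<in>seqs n. joint q \<beta> \<tau> m n f y z v))"
    unfolding cond_ent_def by (intro sum_mono Phi_seqs_le joint_nonneg assms)
  also have "\<dots> = real n"
    by (simp add: sum_joint_y sum_distrib_left [symmetric] sum_half_pow del: sum_constant)
  finally show ?thesis .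
qed

lemma cond_ent_degrade_tau:
  assumes "0 \<le> q" "q \<le> 1" "0 \<le> \<beta>" "\<beta> \<le> 1" "0 \<le> \<tau>" "\<tau> \<le> 1" "0 \<le> r" "r \<le> 1"
  shows "cond_ent q \<beta> \<tau> m n f \<le> cond_ent q \<beta> (bstar \<tau> r) m n f"
  unfolding cond_ent_def
proof (rule sum_mono)
  fix z
  have "(\<Sum>v\<in>seqs m. Phi (seqs n) (\<lambda>y. joint q \<beta> \<tau> m n f y z v))
      \<le> (\<Sum>v'\<in>seqs m. Phi (seqs n) (\<lambda>y. \<Sum>v\<in>seqs m. ker r m v v' * joint q \<beta> \<tau> m n f y z v))"
    using assms by (intro Phi_degrade) (auto intro: joint_nonneg ker_nonneg)
  then show "(\<Sum>v\<in>seqs m. Phi (seqs n) (\<lambda>y. joint q \<beta> \<tau> m n f y z v))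
      \<le> (\<Sum>v\<in>seqs m. Phi (seqs n) (\<lambda>y. joint q \<beta> (bstar \<tau> r) m n f y z v))"
    by (simp add: nz_joint_v [symmetric] nz_def)
qed

lemma cond_ent_degrade_beta:
  assumes "0 \<le> q" "q \<le> 1" "0 \<le> \<beta>" "\<beta> \<le> 1" "0 \<le> \<tau>" "\<tau> \<le> 1" "0 \<le> r" "r \<le> 1"
  shows "cond_ent q \<beta> \<tau> m n f \<le> cond_ent q (bstar \<beta> r) \<tau> m n f"
proof -
  have swap: "cond_ent q \<beta> \<tau> m n f = (\<Sum>v\<in>seqs m. \<Sum>z\<in>seqs m. Phi (seqs n) (\<lambda>y. joint q \<beta> \<tau> m n f y z v))"
    for \<beta> unfolding cond_ent_def by (rule sum.swap)
  show ?thesis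
    unfolding swap
  proof (rule sum_mono)
    fix v
    have "(\<Sum>z\<in>seqs m. Phi (seqs n) (\<lambda>y. joint q \<beta> \<tau> m n f y z v))
        \<le> (\<Sum>z'\<in>seqs m. Phi (seqs n) (\<lambda>y. \<Sum>z\<in>seqs m. ker r m z z' * joint q \<beta> \<tau> m n f y z v))"
      using assms by (intro Phi_degrade) (auto intro: joint_nonneg ker_nonneg)
    then show "(\<Sum>z\<in>seqs m. Phi (seqs n) (\<lambda>y. joint q \<beta> \<tau> m n f y z v))
        \<le> (\<Sum>z\<in>seqs m. Phi (seqs n) (\<lambda>y. joint q (bstar \<beta> r) \<tau> m n f y z v))"
      by (simp add: nz_joint_z [symmetric] nz_def)
  qed
qed

lemma ker_0:
  assumes "x \<in> seqs l" "y \<in> seqs l"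
  shows "ker 0 l x y = (if x = y then 1 else 0)"
proof (cases "x = y")
  case False
  then obtain i where "x i \<noteq> y i" by auto
  moreover from this assms have "i < l" by (force simp: seqs_def PiE_iff extensional_def)
  ultimately show ?thesis using False by (auto simp: ker_def bk_def)
qed (simp add: ker_def bk_def)

text \<open>For \<open>\<tau> = 0\<close> the remote source is the source itself and fixes the
  channel input, so only the channel noise remains. This is what matches the boundary value
  \<open>\<theta> K = 0\<close>.\<close>

lemma cond_ent_0:
  assumes "0 \<le> q" "q \<le> 1" "0 \<le> \<beta>" "\<beta> \<le> 1"
  shows "cond_ent q \<beta> 0 m n f = real n * H2 q"
proof -
  have j: "joint q \<beta> 0 m n f y z v = ((1/2) ^ m * ker \<beta> m v z) * ker q n (f v) y"
    if "v \<in> seqs m" for y z v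
  proof -
    have "joint q \<beta> 0 m n f y z v
        = (\<Sum>s\<in>seqs m. if s = v then (1/2) ^ m * ker \<beta> m s z * ker q n (f s) y else 0)"
      unfolding joint_def using that by (intro sum.cong refl) (simp add: ker_0)
    then show ?thesis using that by simp
  qed
  have "cond_ent q \<beta> 0 m n f
      = (\<Sum>z\<in>seqs m. \<Sum>v\<in>seqs m. (1/2) ^ m * ker \<beta> m v z * (real n * H2 q))"
    unfolding cond_ent_def using assms
    by (intro sum.cong refl) (simp only: j, subst Phi_scale, auto simp: ker_nonneg Phi_ker)
  also have "\<dots> = (\<Sum>v\<in>seqs m. (1/2) ^ m * (\<Sum>z\<in>seqs m. ker \<beta> m v z)) * (real n * H2 q)"
    by (subst sum.swap) (simp add: sum_distrib_left sum_distrib_right del: sum_ker)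
  finally show ?thesis by (simp add: sum_half_pow del: sum_constant)
qed

lemma cond_ent_supporting_line:
  assumes q: "0 \<le> q" "q \<le> 1" "0 \<le> \<beta>" "\<beta> \<le> 1" "0 \<le> \<tau>" "\<tau> \<le> 1" and r: "0 \<le> r" "r \<le> 1"
    and lam: "0 \<le> lam" and line: "\<And>x. 0 \<le> x \<Longrightarrow> x \<le> 1 \<Longrightarrow> C \<le> H2 (bstar r x) - lam * H2 x"
  shows "real n * C \<le> cond_ent (bstar q r) \<beta> \<tau> m n f - lam * cond_ent q \<beta> \<tau> m n f"
proof -
  have "real n * C = (\<Sum>z\<in>seqs m. \<Sum>v\<in>seqs m. real n * C * (\<Sum>y\<in>seqs n. joint q \<beta> \<tau> m n f y z v))"
    by (simp add: sum_joint_y sum_distrib_left [symmetric] sum_half_pow del: sum_constant)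
  also have "\<dots> \<le> (\<Sum>z\<in>seqs m. \<Sum>v\<in>seqs m.
      Phi (seqs n) (nz r n (\<lambda>y. joint q \<beta> \<tau> m n f y z v))
        - lam * Phi (seqs n) (\<lambda>y. joint q \<beta> \<tau> m n f y z v))"
    by (intro sum_mono Phi_nz_supporting_line r lam line joint_nonneg q)
  also have "\<dots> = cond_ent (bstar q r) \<beta> \<tau> m n f - lam * cond_ent q \<beta> \<tau> m n f"
    by (simp add: cond_ent_def nz_joint_y [abs_def] sum_subtractf sum_distrib_left)
  finally show ?thesis .
qed

section \<open>The error probability and the law of a single source bit\<close>

lemma sum_bern_seq_xor:
  "(\<Sum>e\<in>seqs l. bern_seq q l e * F (restrict (\<lambda>i. x i \<noteq> e i) {..<l})) = (\<Sum>y\<in>seqs l. ker q l x y * F y)"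
proof (rule sum.reindex_bij_witness [where i = "\<lambda>y. restrict (\<lambda>i. x i \<noteq> y i) {..<l}"
      and j = "\<lambda>e. restrict (\<lambda>i. x i \<noteq> e i) {..<l}"])
  fix e assume e: "e \<in> seqs l"
  show "restrict (\<lambda>i. x i \<noteq> e i) {..<l} \<in> seqs l" by (simp add: seqs_def)
  show "restrict (\<lambda>i. x i \<noteq> restrict (\<lambda>i. x i \<noteq> e i) {..<l} i) {..<l} = e"
    using e by (auto simp: seqs_def fun_eq_iff restrict_def PiE_iff extensional_def)
  have "ker q l x (restrict (\<lambda>i. x i \<noteq> e i) {..<l}) = bern_seq q l e"
    unfolding ker_def bern_seq_def by (intro prod.cong refl) (auto simp: bk_def)
  then show "ker q l x (restrict (\<lambda>i. x i \<noteq> e i) {..<l}) * F (restrict (\<lambda>i. x i \<noteq> e i) {..<l})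
      = bern_seq q l e * F (restrict (\<lambda>i. x i \<noteq> e i) {..<l})" by simp
next
  fix y assume y: "y \<in> seqs l"
  show "restrict (\<lambda>i. x i \<noteq> y i) {..<l} \<in> seqs l" by (simp add: seqs_def)
  show "restrict (\<lambda>i. x i \<noteq> restrict (\<lambda>i. x i \<noteq> y i) {..<l} i) {..<l} = y"
    using y by (auto simp: seqs_def fun_eq_iff restrict_def PiE_iff extensional_def)
qed

lemma err_prob_eq:
  "err_prob q \<beta> m n f g t = (\<Sum>y\<in>seqs n. \<Sum>z\<in>seqs m. \<Sum>s\<in>seqs m.
     (1/2) ^ m * ker \<beta> m s z * ker q n (f s) y * (if g y z t \<noteq> s t then 1 else 0))"
proof -
  have "err_prob q \<beta> m n f g t = (\<Sum>z\<in>seqs m. \<Sum>bb\<in>seqs m. bern_seq \<beta> m bb *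
      (\<lambda>s. (1/2) ^ m * (\<Sum>w\<in>seqs n. bern_seq q n w *
        (\<lambda>y. if g y z t \<noteq> s t then 1 else 0) (restrict (\<lambda>i. f s i \<noteq> w i) {..<n})))
      (restrict (\<lambda>i. z i \<noteq> bb i) {..<m}))"
    unfolding err_prob_def Let_def sum_distrib_left
    by (intro sum.cong refl) (simp only: mult_ac)
  also have "\<dots> = (\<Sum>z\<in>seqs m. \<Sum>s\<in>seqs m. ker \<beta> m z s * ((1/2) ^ m *
      (\<Sum>y\<in>seqs n. ker q n (f s) y * (if g y z t \<noteq> s t then 1 else 0))))"
  proof (rule sum.cong [OF refl])
    fix z
    have inner: "(\<Sum>w\<in>seqs n. bern_seq q n w *
        (\<lambda>y. if g y z t \<noteq> s t then 1 else 0) (restrict (\<lambda>i. f s i \<noteq> w i) {..<n}))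
      = (\<Sum>y\<in>seqs n. ker q n (f s) y * (if g y z t \<noteq> s t then 1 else 0))" for s
      by (rule sum_bern_seq_xor [where F = "\<lambda>y. if g y z t \<noteq> s t then 1 else 0"])
    show "(\<Sum>bb\<in>seqs m. bern_seq \<beta> m bb *
        (\<lambda>s. (1/2) ^ m * (\<Sum>w\<in>seqs n. bern_seq q n w *
          (\<lambda>y. if g y z t \<noteq> s t then 1 else 0) (restrict (\<lambda>i. f s i \<noteq> w i) {..<n})))
        (restrict (\<lambda>i. z i \<noteq> bb i) {..<m}))
      = (\<Sum>s\<in>seqs m. ker \<beta> m z s * ((1/2) ^ m *
          (\<Sum>y\<in>seqs n. ker q n (f s) y * (if g y z t \<noteq> s t then 1 else 0))))"
      unfolding inner by (rule sum_bern_seq_xor [where F = "\<lambda>s. (1/2) ^ m *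
          (\<Sum>y\<in>seqs n. ker q n (f s) y * (if g y z t \<noteq> s t then 1 else 0))"])
  qed
  also have "\<dots> = (\<Sum>z\<in>seqs m. \<Sum>s\<in>seqs m. \<Sum>y\<in>seqs n.
      (1/2) ^ m * ker \<beta> m s z * ker q n (f s) y * (if g y z t \<noteq> s t then 1 else 0))"
    unfolding sum_distrib_left
    by (intro sum.cong refl) (simp only: mult_ac ker_sym [of \<beta> m _ z for z])
  also have "\<dots> = (\<Sum>z\<in>seqs m. \<Sum>y\<in>seqs n. \<Sum>s\<in>seqs m.
      (1/2) ^ m * ker \<beta> m s z * ker q n (f s) y * (if g y z t \<noteq> s t then 1 else 0))"
    by (intro sum.cong refl sum.swap)
  also have "\<dots> = (\<Sum>y\<in>seqs n. \<Sum>z\<in>seqs m. \<Sum>s\<in>seqs m.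
      (1/2) ^ m * ker \<beta> m s z * ker q n (f s) y * (if g y z t \<noteq> s t then 1 else 0))"
    by (rule sum.swap)
  finally show ?thesis .
qed

text \<open>Makes bit \<open>t\<close> a summation variable of its own while the outer sum still
  runs over full sequences. Every sequence is then hit twice, whence the division by 2.\<close>

lemma sum_seqs_resample:
  fixes F :: "(nat \<Rightarrow> bool) \<Rightarrow> real"
  assumes t: "t < l"
  shows "(\<Sum>z\<in>seqs l. F z) = (\<Sum>z\<in>seqs l. \<Sum>c\<in>UNIV. F (z(t := c)) / 2)"
proof -
  have "(\<Sum>z\<in>seqs l. F z) = (\<Sum>z\<in>seqs l. F (z(t := \<not> z t)))"
    by (rule sum.reindex_bij_witness [where i = "\<lambda>z. z(t := \<not> z t)" and j = "\<lambda>z. z(t := \<not> z t)"])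
      (use t in \<open>auto simp: seqs_upd_less simp del: fun_upd_apply simp: fun_upd_same\<close>)
  then have "2 * (\<Sum>z\<in>seqs l. F z) = (\<Sum>z\<in>seqs l. F (z(t := z t)) + F (z(t := \<not> z t)))"
    by (simp add: sum.distrib)
  also have "\<dots> = (\<Sum>z\<in>seqs l. \<Sum>c\<in>UNIV. F (z(t := c)))"
  proof (rule sum.cong)
    fix z show "F (z(t := z t)) + F (z(t := \<not> z t)) = (\<Sum>c\<in>UNIV. F (z(t := c)))"
      by (cases "z t") (simp_all only: UNIV_bool, simp_all)
  qed simp
  finally show ?thesis by (simp add: sum_divide_distrib [symmetric])
qed

lemma sum_seqs_by_bit:
  fixes F :: "(nat \<Rightarrow> bool) \<Rightarrow> real"
  shows "(\<Sum>s\<in>seqs l. F s) = (\<Sum>a\<in>UNIV. \<Sum>s | s \<in> seqs l \<and> s t = a. F s)"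
  using sum.group [of "seqs l" "UNIV :: bool set" "\<lambda>s. s t" F] by simp

lemma ker_upd:
  assumes "t < l"
  shows "ker q l x (y(t := b)) = (\<Prod>i\<in>{..<l} - {t}. bk q (x i) (y i)) * bk q (x t) b"
proof -
  have "ker q l x (y(t := b)) = bk q (x t) b * (\<Prod>i\<in>{..<l} - {t}. bk q (x i) ((y(t := b)) i))"
    unfolding ker_def using assms by (subst prod.remove [of _ t]) auto
  also have "(\<Prod>i\<in>{..<l} - {t}. bk q (x i) ((y(t := b)) i)) = (\<Prod>i\<in>{..<l} - {t}. bk q (x i) (y i))"
    by (intro prod.cong) auto
  finally show ?thesis by (simp only: mult.commute)
qed

text \<open>The joint law of the source bit \<open>t\<close> (the argument \<open>a\<close>), the channel output and the side
  information without its bit \<open>t\<close>; the factor \<open>1/2\<close> makes up for \<open>z t\<close> being a free index.\<close>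

definition bit_law :: "real \<Rightarrow> real \<Rightarrow> nat \<Rightarrow> nat \<Rightarrow> ((nat \<Rightarrow> bool) \<Rightarrow> nat \<Rightarrow> bool) \<Rightarrow> nat
    \<Rightarrow> (nat \<Rightarrow> bool) \<Rightarrow> (nat \<Rightarrow> bool) \<Rightarrow> bool \<Rightarrow> real" where
  "bit_law q \<beta> m n f t y z a = (\<Sum>s | s \<in> seqs m \<and> s t = a.
     (1/2) ^ m * (\<Prod>i\<in>{..<m} - {t}. bk \<beta> (s i) (z i)) * ker q n (f s) y) / 2"

lemma bit_law_nonneg:
  "0 \<le> q \<Longrightarrow> q \<le> 1 \<Longrightarrow> 0 \<le> \<beta> \<Longrightarrow> \<beta> \<le> 1 \<Longrightarrow> 0 \<le> bit_law q \<beta> m n f t y z a"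
  unfolding bit_law_def
  by (intro divide_nonneg_nonneg sum_nonneg mult_nonneg_nonneg prod_nonneg ker_nonneg bk_nonneg ballI) auto

text \<open>The side-information bit at \<open>t\<close> depends on the source only through its bit
  at \<open>t\<close>, so its kernel leaves the sum as the factor
  \<open>bk \<beta> a c\<close>.\<close>

lemma sum_source_bit_law:
  assumes "t < m"
  shows "(\<Sum>s\<in>seqs m. (1/2) ^ m * ker \<beta> m s (z(t := c)) * ker q n (f s) y * G (s t)) / 2
    = (\<Sum>a\<in>UNIV. bit_law q \<beta> m n f t y z a * bk \<beta> a c * G a)"
proof -
  have "(\<Sum>s | s \<in> seqs m \<and> s t = a. (1/2) ^ m * ker \<beta> m s (z(t := c)) * ker q n (f s) y * G (s t)) / 2
      = bit_law q \<beta> m n f t y z a * bk \<beta> a c * G a" for a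
    unfolding bit_law_def sum_divide_distrib sum_distrib_right
    by (intro sum.cong refl) (auto simp: ker_upd [OF assms] mult_ac)
  then show ?thesis
    by (simp add: sum_seqs_by_bit [where t = t] sum_divide_distrib)
qed

lemma sum_bit_law:
  assumes "t < m"
  shows "(\<Sum>y\<in>seqs n. \<Sum>z\<in>seqs m. \<Sum>s\<in>seqs m. (1/2) ^ m * ker \<beta> m s z * ker q n (f s) y * G y z (s t))
    = (\<Sum>y\<in>seqs n. \<Sum>z\<in>seqs m. \<Sum>c\<in>UNIV. \<Sum>a\<in>UNIV.
        bit_law q \<beta> m n f t y z a * bk \<beta> a c * G y (z(t := c)) a)"
proof (rule sum.cong [OF refl])
  fix y
  have "(\<Sum>z\<in>seqs m. \<Sum>s\<in>seqs m. (1/2) ^ m * ker \<beta> m s z * ker q n (f s) y * G y z (s t))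
      = (\<Sum>z\<in>seqs m. \<Sum>c\<in>UNIV. (\<Sum>s\<in>seqs m. (1/2) ^ m * ker \<beta> m s (z(t := c)) * ker q n (f s) y *
          G y (z(t := c)) (s t)) / 2)"
    by (rule sum_seqs_resample [OF assms])
  then show "(\<Sum>z\<in>seqs m. \<Sum>s\<in>seqs m. (1/2) ^ m * ker \<beta> m s z * ker q n (f s) y * G y z (s t))
      = (\<Sum>z\<in>seqs m. \<Sum>c\<in>UNIV. \<Sum>a\<in>UNIV. bit_law q \<beta> m n f t y z a * bk \<beta> a c * G y (z(t := c)) a)"
    by (simp only: sum_source_bit_law [OF assms])
qed

lemma bit_law_mass:
  assumes "t < m"
  shows "(\<Sum>y\<in>seqs n. \<Sum>z\<in>seqs m. bit_law q \<beta> m n f t y z True + bit_law q \<beta> m n f t y z False) = 1"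
proof -
  let ?X = "\<lambda>y z s. (1/2) ^ m * ker \<beta> m s z * ker q n (f s) y * (1::real)"
  have e: "(\<Sum>c\<in>UNIV. \<Sum>a\<in>UNIV. bit_law q \<beta> m n f t y z a * bk \<beta> a c * 1)
      = bit_law q \<beta> m n f t y z True + bit_law q \<beta> m n f t y z False" for y z
    by (simp add: UNIV_bool bk_def algebra_simps)
  have "(\<Sum>y\<in>seqs n. \<Sum>z\<in>seqs m. bit_law q \<beta> m n f t y z True + bit_law q \<beta> m n f t y z False)
      = (\<Sum>y\<in>seqs n. \<Sum>z\<in>seqs m. \<Sum>s\<in>seqs m. (1/2) ^ m * ker \<beta> m s z * ker q n (f s) y * 1)"
    by (simp only: sum_bit_law [OF assms, where G = "\<lambda>_ _ _. 1"] e)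
  also have "\<dots> = (\<Sum>y\<in>seqs n. \<Sum>s\<in>seqs m. \<Sum>z\<in>seqs m. ?X y z s)"
    by (rule sum.cong [OF refl]) (rule sum.swap)
  also have "\<dots> = (\<Sum>s\<in>seqs m. \<Sum>y\<in>seqs n. \<Sum>z\<in>seqs m. ?X y z s)"
    by (rule sum.swap)
  also have "\<dots> = (\<Sum>s\<in>seqs m. (1/2) ^ m * (\<Sum>z\<in>seqs m. ker \<beta> m s z) * (\<Sum>y\<in>seqs n. ker q n (f s) y))"
    by (simp only: sum_distrib_left sum_distrib_right mult_1_right)
  also have "\<dots> = 1" by (simp add: sum_half_pow del: sum_constant)
  finally show ?thesis .
qed

lemma sum_joint_bit:
  assumes "t < m"
  shows "(\<Sum>v | v \<in> seqs m \<and> v t = b. joint q \<beta> \<tau> m n f y (z(t := c)) v)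
    = 2 * nb \<tau> (\<lambda>a. bk \<beta> a c * bit_law q \<beta> m n f t y z a) b"
proof -
  have "(\<Sum>v | v \<in> seqs m \<and> v t = b. joint q \<beta> \<tau> m n f y (z(t := c)) v)
      = (\<Sum>s\<in>seqs m. (1/2) ^ m * ker \<beta> m s (z(t := c)) * ker q n (f s) y *
          (\<Sum>v | v \<in> seqs m \<and> v t = b. ker \<tau> m s v))"
    unfolding joint_def sum_distrib_left by (subst sum.swap) (simp only: mult_ac)
  also have "\<dots> = (\<Sum>s\<in>seqs m. (1/2) ^ m * ker \<beta> m s (z(t := c)) * ker q n (f s) y * bk \<tau> (s t) b)"
    by (simp only: ker_marginal [OF assms])
  also have "\<dots> = 2 * (\<Sum>a\<in>UNIV. bit_law q \<beta> m n f t y z a * bk \<beta> a c * bk \<tau> a b)"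
    using sum_source_bit_law [OF assms, where G = "\<lambda>a. bk \<tau> a b"] by simp
  finally show ?thesis by (simp add: nb_def mult_ac)
qed

lemma sum_rho_joint:
  assumes t: "t < m" and r: "0 \<le> q" "q \<le> 1" "0 \<le> \<beta>" "\<beta> \<le> 1" "0 \<le> \<tau>" "\<tau> \<le> 1" "0 \<le> \<delta>" "\<delta> \<le> 1"
  shows "(\<Sum>z\<in>seqs m. rho \<delta> (\<lambda>b. \<Sum>v | v \<in> seqs m \<and> v t = b. joint q \<beta> \<tau> m n f y z v))
    = (\<Sum>z\<in>seqs m. equivocation_gap \<beta> \<tau> \<delta> (bit_law q \<beta> m n f t y z))"
proof -
  have "rho \<delta> (\<lambda>b. 2 * nb \<tau> (\<lambda>a. bk \<beta> a c * bit_law q \<beta> m n f t y z a) b) / 2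
      = rho \<delta> (nb \<tau> (\<lambda>a. bk \<beta> a c * bit_law q \<beta> m n f t y z a))" for z c
    using r by (subst rho_scale) (auto intro!: nb_nonneg mult_nonneg_nonneg bk_nonneg bit_law_nonneg)
  then show ?thesis
    by (subst sum_seqs_resample [OF t]) (simp only: sum_joint_bit [OF t] equivocation_gap_def)
qed

text \<open>The chain rule \<open>H(Y|Z,V) = H(V|Y,Z) - H(V|Z) + H(Y|Z)\<close>. The last bracket
  does not depend on \<open>\<tau>\<close>, so it cancels in differences.\<close>

lemma cond_ent_eq:
  assumes "0 \<le> q" "q \<le> 1" "0 \<le> \<beta>" "\<beta> \<le> 1" "0 \<le> \<tau>" "\<tau> \<le> 1"
  shows "cond_ent q \<beta> \<tau> m n f = (\<Sum>y\<in>seqs n. \<Sum>z\<in>seqs m. Phi (seqs m) (joint q \<beta> \<tau> m n f y z))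
      - real m * H2 (bstar \<beta> \<tau>)
      + ((\<Sum>y\<in>seqs n. \<Sum>z\<in>seqs m. nlog (\<Sum>s\<in>seqs m. (1/2) ^ m * ker \<beta> m s z * ker q n (f s) y))
        - (\<Sum>z\<in>seqs m. nlog ((1/2) ^ m)))"
proof -
  let ?P = "joint q \<beta> \<tau> m n f" and ?G = "\<lambda>z v. (1/2) ^ m * ker (bstar \<beta> \<tau>) m z v"
  let ?Q = "\<lambda>y z. \<Sum>s\<in>seqs m. (1/2) ^ m * ker \<beta> m s z * ker q n (f s) y"
  have b: "0 \<le> bstar \<beta> \<tau>" "bstar \<beta> \<tau> \<le> 1" using assms by (auto intro: bstar_nonneg bstar_le_1)
  have Q: "(\<Sum>v\<in>seqs m. ?P y z v) = ?Q y z" for y z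
  proof -
    have "(\<Sum>v\<in>seqs m. ?P y z v)
        = (\<Sum>s\<in>seqs m. (1/2) ^ m * ker \<beta> m s z * ker q n (f s) y * (\<Sum>v\<in>seqs m. ker \<tau> m s v))"
      unfolding joint_def sum_distrib_left by (subst sum.swap) (simp only: mult_ac)
    then show ?thesis by simp
  qed
  have "cond_ent q \<beta> \<tau> m n f = (\<Sum>z\<in>seqs m. \<Sum>v\<in>seqs m. \<Sum>y\<in>seqs n. nlog (?P y z v))
      - (\<Sum>z\<in>seqs m. \<Sum>v\<in>seqs m. nlog (?G z v))"
    by (simp add: cond_ent_def Phi_def sum_joint_y sum_subtractf)
  also have "(\<Sum>z\<in>seqs m. \<Sum>v\<in>seqs m. \<Sum>y\<in>seqs n. nlog (?P y z v))
      = (\<Sum>z\<in>seqs m. \<Sum>y\<in>seqs n. \<Sum>v\<in>seqs m. nlog (?P y z v))"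
    by (intro sum.cong refl sum.swap)
  also have "\<dots> = (\<Sum>y\<in>seqs n. \<Sum>z\<in>seqs m. \<Sum>v\<in>seqs m. nlog (?P y z v))"
    by (rule sum.swap)
  also have "\<dots> = (\<Sum>y\<in>seqs n. \<Sum>z\<in>seqs m. Phi (seqs m) (?P y z)) + (\<Sum>y\<in>seqs n. \<Sum>z\<in>seqs m. nlog (?Q y z))"
    by (simp add: Phi_def Q sum_subtractf)
  also have "(\<Sum>z\<in>seqs m. \<Sum>v\<in>seqs m. nlog (?G z v)) = real m * H2 (bstar \<beta> \<tau>) + (\<Sum>z\<in>seqs m. nlog ((1/2) ^ m))"
  proof -
    have "(\<Sum>v\<in>seqs m. nlog (?G z v)) = (1/2) ^ m * (real m * H2 (bstar \<beta> \<tau>)) + nlog ((1/2) ^ m)" for z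
    proof -
      have "Phi (seqs m) (?G z) = (1/2) ^ m * (real m * H2 (bstar \<beta> \<tau>))"
        using b by (subst Phi_scale) (auto simp: ker_nonneg Phi_ker)
      then show ?thesis by (simp add: Phi_def sum_distrib_left [symmetric])
    qed
    then show ?thesis
      by (simp add: sum.distrib sum_distrib_right [symmetric] sum_half_pow del: sum_constant)
  qed
  finally show ?thesis by simp
qed

text \<open>By \<open>cond_ent_eq\<close> only the terms \<open>H(V|Y,Z)\<close> and
  \<open>H(V|Z)\<close> change with \<open>\<tau>\<close>. The second is explicit; the growth of the
  first is single-letterized by \<open>Phi_nz_ge_sum_rho\<close>.\<close>

lemma cond_ent_gain:
  assumes r: "0 \<le> q" "q \<le> 1" "0 \<le> \<beta>" "\<beta> \<le> 1" "0 \<le> \<tau>" "\<tau> \<le> 1" "0 \<le> \<delta>" "\<delta> \<le> 1"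
  shows "(\<Sum>t<m. \<Sum>y\<in>seqs n. \<Sum>z\<in>seqs m. equivocation_gap \<beta> \<tau> \<delta> (bit_law q \<beta> m n f t y z))
      - real m * (H2 (bstar \<beta> (bstar \<tau> \<delta>)) - H2 (bstar \<beta> \<tau>))
    \<le> cond_ent q \<beta> (bstar \<tau> \<delta>) m n f - cond_ent q \<beta> \<tau> m n f"
proof -
  let ?P = "joint q \<beta> \<tau> m n f"
  let ?rho = "\<lambda>t y z. rho \<delta> (\<lambda>b. \<Sum>v | v \<in> seqs m \<and> v t = b. ?P y z v)"
  have b: "0 \<le> bstar \<tau> \<delta>" "bstar \<tau> \<delta> \<le> 1" using r by (auto intro: bstar_nonneg bstar_le_1)
  have "(\<Sum>t<m. \<Sum>y\<in>seqs n. \<Sum>z\<in>seqs m. equivocation_gap \<beta> \<tau> \<delta> (bit_law q \<beta> m n f t y z))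
      = (\<Sum>t<m. \<Sum>y\<in>seqs n. \<Sum>z\<in>seqs m. ?rho t y z)"
    using r by (intro sum.cong refl sum_rho_joint [symmetric]) auto
  also have "\<dots> = (\<Sum>y\<in>seqs n. \<Sum>z\<in>seqs m. \<Sum>t<m. ?rho t y z)"
    by (subst sum.swap, intro sum.cong refl, subst sum.swap, rule refl)
  also have "\<dots> \<le> (\<Sum>y\<in>seqs n. \<Sum>z\<in>seqs m. Phi (seqs m) (nz \<delta> m (?P y z)) - Phi (seqs m) (?P y z))"
    using r by (intro sum_mono Phi_nz_ge_sum_rho joint_nonneg) auto
  also have "\<dots> = (\<Sum>y\<in>seqs n. \<Sum>z\<in>seqs m. Phi (seqs m) (joint q \<beta> (bstar \<tau> \<delta>) m n f y z))
      - (\<Sum>y\<in>seqs n. \<Sum>z\<in>seqs m. Phi (seqs m) (?P y z))"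
    by (simp add: nz_joint_v [abs_def] sum_subtractf)
  finally show ?thesis
    using cond_ent_eq [of q \<beta> \<tau> m n f] cond_ent_eq [of q \<beta> "bstar \<tau> \<delta>" m n f] r b
    by (simp add: right_diff_distrib)
qed

text \<open>\<open>guess_tradeoff\<close> is applied to all triples of a position \<open>t\<close>,
  an output \<open>y\<close> and a side-information sequence \<open>z\<close> at once, so a single
  \<open>\<alpha>\<close> accounts for all positions. Given such a triple, the guess is a function
  of the side-information bit at \<open>t\<close> alone.\<close>

lemma source_converse:
  assumes r: "0 \<le> q" "q \<le> 1" "0 \<le> \<beta>" "\<beta> \<le> 1/2" and m: "0 < m"
    and d: "d = (1 / real m) * (\<Sum>t<m. err_prob q \<beta> m n f g t)"
  obtains \<alpha> where "0 \<le> \<alpha>" "\<alpha> \<le> d" "\<alpha> \<le> \<beta>"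
    "\<And>\<tau> \<tau>'. \<lbrakk>0 \<le> \<tau>; \<tau> \<le> \<tau>'; \<tau>' \<le> 1/2\<rbrakk> \<Longrightarrow>
      real m * (eta \<alpha> \<beta> (min d \<beta>) *
        (H2 (bstar \<beta> \<tau>) - H2 (bstar \<beta> \<tau>') - (H4 \<alpha> \<beta> \<tau> - H4 \<alpha> \<beta> \<tau>')))
      \<le> cond_ent q \<beta> \<tau>' m n f - cond_ent q \<beta> \<tau> m n f"
proof -
  let ?I = "{..<m} \<times> seqs n \<times> seqs m"
  let ?w = "\<lambda>(t, y, z). bit_law q \<beta> m n f t y z" and ?h = "\<lambda>(t, y, z) c. g y (z(t := c)) t"
  have sumI: "(\<Sum>i\<in>?I. F i) = (\<Sum>t<m. \<Sum>y\<in>seqs n. \<Sum>z\<in>seqs m. F (t, y, z))" for F :: "_ \<Rightarrow> real"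
    by (simp add: sum.cartesian_product)
  have mass: "(\<Sum>i\<in>?I. ?w i True + ?w i False) = real m"
    by (simp add: sumI bit_law_mass)
  have "err_prob q \<beta> m n f g t = (\<Sum>y\<in>seqs n. \<Sum>z\<in>seqs m. \<Sum>c\<in>UNIV. \<Sum>a\<in>UNIV.
      bit_law q \<beta> m n f t y z a * bk \<beta> a c * (if g y (z(t := c)) t \<noteq> a then 1 else 0))" if "t < m" for t
    unfolding err_prob_eq by (rule sum_bit_law [OF that, where G = "\<lambda>y z a. if g y z t \<noteq> a then 1 else 0"])
  then have err: "real m * d = (\<Sum>i\<in>?I. \<Sum>c\<in>UNIV. \<Sum>a\<in>UNIV. ?w i a * bk \<beta> a c * (if ?h i c \<noteq> a then 1 else 0))"
    using m by (simp add: d sumI)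
  have I: "finite ?I" by simp
  have w: "0 \<le> ?w i a" for i a using r by (auto simp: case_prod_beta intro!: bit_law_nonneg)
  have m': "0 < real m" using m by simp
  obtain \<alpha> where \<alpha>: "0 \<le> \<alpha>" "\<alpha> \<le> d" "\<alpha> \<le> \<beta>"
    and gain: "\<And>R. sublinear_symmetric R \<Longrightarrow>
      real m * (eta \<alpha> \<beta> (min d \<beta>) * (R (bk \<alpha> False) - R (bk (1/2) False)))
      \<le> (\<Sum>i\<in>?I. R (?w i)) - real m * R (bk (1/2) False)"
    using guess_tradeoff [of ?I ?w "real m" \<beta> d ?h, OF I w m' mass r(3,4) err] by blast
  show ?thesis
  proof (rule that [OF \<alpha>])
    fix \<tau> \<tau>' :: real assume \<tau>: "0 \<le> \<tau>" "\<tau> \<le> \<tau>'" "\<tau>' \<le> 1/2"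
    obtain \<delta> where \<delta>: "0 \<le> \<delta>" "\<delta> \<le> 1/2" "\<tau>' = bstar \<tau> \<delta>"
      by (rule ex_bstar_factor [OF \<tau>])
    \<comment> \<open>The value at the uniform law supplies the \<open>H2\<close> terms of the
      bound.\<close>
    have half: "equivocation_gap \<beta> \<tau> \<delta> (bk (1/2) False) = H2 (bstar \<beta> \<tau>') - H2 (bstar \<beta> \<tau>)"
      unfolding equivocation_gap_bk using r \<tau> by (simp add: H4_half \<delta>(3) [symmetric])
    have "real m * (eta \<alpha> \<beta> (min d \<beta>) *
        (equivocation_gap \<beta> \<tau> \<delta> (bk \<alpha> False) - equivocation_gap \<beta> \<tau> \<delta> (bk (1/2) False)))
      \<le> (\<Sum>i\<in>?I. equivocation_gap \<beta> \<tau> \<delta> (?w i)) - real m * equivocation_gap \<beta> \<tau> \<delta> (bk (1/2) False)"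
      by (intro gain equivocation_gap_sublinear) (use r \<tau> \<delta> in auto)
    also have "\<dots> \<le> cond_ent q \<beta> \<tau>' m n f - cond_ent q \<beta> \<tau> m n f"
      using cond_ent_gain [of q \<beta> \<tau> \<delta> m n f] r \<tau> \<delta> by (simp add: sumI half)
    finally show "real m * (eta \<alpha> \<beta> (min d \<beta>) *
        (H2 (bstar \<beta> \<tau>) - H2 (bstar \<beta> \<tau>') - (H4 \<alpha> \<beta> \<tau> - H4 \<alpha> \<beta> \<tau>')))
      \<le> cond_ent q \<beta> \<tau>' m n f - cond_ent q \<beta> \<tau> m n f"
      unfolding half unfolding equivocation_gap_bk \<delta>(3) [symmetric] by (simp add: algebra_simps)
  qed
qed

section \<open>The channel converse\<close>

lemma H2_mono:
  assumes "0 \<le> x" "x \<le> y" "y \<le> 1/2"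
  shows "H2 x \<le> H2 y"
proof -
  have *: "H2 u \<le> H2 y" if "u \<in> {0<..<y}" for u
  proof (rule DERIV_nonneg_imp_nondecreasing [of u y])
    fix v assume "u \<le> v" "v \<le> y"
    then have v: "0 < v" "v \<le> 1/2" using that assms by auto
    then have "0 \<le> ln ((1 - v) / v)" by (intro ln_ge_zero) (simp add: field_simps)
    then show "\<exists>D. (H2 has_real_derivative D) (at v) \<and> 0 \<le> D"
      using H2_deriv [of v] v by (intro exI conjI) auto
  qed (use that in auto)
  show ?thesis
  proof (cases "x = y")
    case False
    have "closure {0<..<y} \<subseteq> {u \<in> {0..y}. H2 u \<le> H2 y}"
    proof (rule closure_minimal)
      show "closed {u \<in> {0..y}. H2 u \<le> H2 y}"
        using assms by (intro continuous_on_closed_Collect_le continuous_intros) auto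
    qed (use * in auto)
    then show ?thesis using False assms by auto
  qed simp
qed

text \<open>Write \<open>E'\<close> and \<open>E\<close> for the entropies with crossovers
  \<open>q'\<close> and \<open>q\<close>, both with side information \<open>\<beta>\<close>; passing
  from \<open>\<beta>'\<close> to \<open>\<beta>\<close> only lowers \<open>E'\<close>. A supporting
  line bounds \<open>E' - lam * E\<close> from below, so an upper bound on \<open>E'\<close> yields
  one on \<open>E\<close>, as \<open>lam\<close> is positive. For \<open>q' = 1/2\<close> the
  premise \<open>le\<close> carries no information about \<open>\<theta>\<close>, whence the
  assumption \<open>half\<close>.\<close>

lemma Mrs_Gerber_step:
  assumes n: "0 < n"
    and q: "0 \<le> q" "q \<le> q'" "q' \<le> 1/2" and \<beta>: "0 \<le> \<beta>" "\<beta> \<le> \<beta>'" "\<beta>' \<le> 1/2"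
    and \<tau>: "0 \<le> \<tau>" "\<tau> \<le> 1/2" and \<theta>: "0 \<le> \<theta>" "\<theta> \<le> 1/2"
    and le: "cond_ent q' \<beta>' \<tau> m n f \<le> real n * H2 (bstar \<theta> q')" and half: "q' = 1/2 \<Longrightarrow> \<theta> = 1/2"
  shows "cond_ent q \<beta> \<tau> m n f \<le> real n * H2 (bstar \<theta> q)"
proof -
  define x0 where "x0 = bstar q \<theta>"
  have x0: "0 \<le> x0" unfolding x0_def using q \<theta> by (intro bstar_nonneg) auto
  have x0_le: "x0 \<le> 1/2" unfolding x0_def using q \<theta> by (intro bstar_le_half) auto
  let ?E = "cond_ent q \<beta> \<tau> m n f"
  show ?thesis
  proof (cases "x0 = 1/2")
    case True
    then have "bstar \<theta> q = 1/2" using bstar_commute [of \<theta> q] unfolding x0_def by simp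
    then show ?thesis
      using cond_ent_le [of q \<beta> \<tau> m n f] q \<beta> \<tau> by (simp only: H2_half) simp
  next
    case False
    then have "q' \<noteq> 1/2" using half unfolding x0_def by (metis bstar_half(2))
    then have "q' < 1/2" using q by simp
    obtain r where r: "0 \<le> r" "r \<le> 1/2" "q' = bstar q r"
      by (rule ex_bstar_factor [OF q])
    have "r \<noteq> 1/2" using \<open>q' < 1/2\<close> r(3) by (metis bstar_half(2) less_irrefl)
    then have r': "r < 1/2" using r(2) by simp
    obtain g where g: "0 \<le> g" "g \<le> 1/2" "\<beta>' = bstar \<beta> g"
      by (rule ex_bstar_factor [OF \<beta>])
    have "cond_ent q' \<beta> \<tau> m n f \<le> cond_ent q' \<beta>' \<tau> m n f"
      unfolding g(3) by (rule cond_ent_degrade_beta) (use q \<beta> \<tau> g(1,2) in linarith)+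
    also have "\<dots> \<le> real n * H2 (bstar r x0)"
    proof -
      have "bstar \<theta> q' = bstar r x0"
        unfolding x0_def r(3) by (simp add: bstar_def algebra_simps)
      then show ?thesis using le by simp
    qed
    finally have upper: "cond_ent q' \<beta> \<tau> m n f \<le> real n * H2 (bstar r x0)" .
    \<comment> \<open>Supporting lines are available only inside the open interval, and
      \<open>x0\<close> may be 0. The bound is shown to the right of \<open>x0\<close> and
      transferred to \<open>x0\<close> by continuity.\<close>
    have above: "?E / real n \<le> H2 x" if "x \<in> {x0<..<1/2}" for x
    proof -
      have x: "0 < x" "x < 1/2" "x0 \<le> x" using that x0 by auto
      obtain lam where lam: "0 < lam" "\<And>y. 0 \<le> y \<Longrightarrow> y \<le> 1 \<Longrightarrow>
          H2 (bstar r x) - lam * H2 x \<le> H2 (bstar r y) - lam * H2 y"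
        using H2_bstar_supporting_line [OF r(1) r' x(1,2)] by blast
      have "real n * (H2 (bstar r x) - lam * H2 x) \<le> cond_ent q' \<beta> \<tau> m n f - lam * ?E"
        unfolding r(3) by (rule cond_ent_supporting_line) (use q \<beta> \<tau> r(1,2) lam in \<open>auto\<close>)
      moreover have "real n * H2 (bstar r x0) \<le> real n * H2 (bstar r x)"
        using x x0 x0_le r by (intro mult_left_mono H2_mono bstar_mono bstar_le_half bstar_nonneg) auto
      ultimately have "lam * ?E \<le> lam * (real n * H2 x)"
        using upper by (simp add: algebra_simps)
      then have "?E \<le> real n * H2 x" using lam by simp
      then show ?thesis using n by (simp add: field_simps)
    qed
    have "closure {x0<..<1/2} \<subseteq> {x \<in> {x0..1/2}. ?E / real n \<le> H2 x}"
    proof (rule closure_minimal)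
      show "closed {x \<in> {x0..1/2}. ?E / real n \<le> H2 x}"
        using x0 x0_le by (intro continuous_on_closed_Collect_le continuous_intros) auto
    qed (use above in auto)
    then have "?E / real n \<le> H2 x0" using False x0 x0_le by auto
    moreover have "x0 = bstar \<theta> q" unfolding x0_def by (rule bstar_commute)
    ultimately show ?thesis using n by (simp add: field_simps)
  qed
qed

lemma cond_ent_ge:
  assumes "0 \<le> q" "q \<le> 1" "0 \<le> \<beta>" "\<beta> \<le> 1" "0 \<le> \<tau>" "\<tau> \<le> 1"
  shows "real n * H2 q \<le> cond_ent q \<beta> \<tau> m n f"
  using cond_ent_degrade_tau [of q \<beta> 0 \<tau> m n f] assms by (simp add: cond_ent_0)

lemma cond_ent_mono_tau:
  assumes "0 \<le> q" "q \<le> 1" "0 \<le> \<beta>" "\<beta> \<le> 1" "0 \<le> \<tau>" "\<tau> \<le> \<tau>'" "\<tau>' \<le> 1/2"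
  shows "cond_ent q \<beta> \<tau> m n f \<le> cond_ent q \<beta> \<tau>' m n f"
proof -
  obtain r where "0 \<le> r" "r \<le> 1/2" "\<tau>' = bstar \<tau> r" by (rule ex_bstar_factor [OF assms(5-7)])
  then show ?thesis using assms by (auto intro!: cond_ent_degrade_tau)
qed

text \<open>The intermediate value theorem between \<open>bstar 0 q = q\<close>, where
  \<open>cond_ent_ge\<close> applies, and the given \<open>\<theta>\<close>. For
  \<open>q = 1/2\<close> the function is constant, and the solution \<open>1/2\<close> is selected
  because \<open>Mrs_Gerber_step\<close> asks for it at the next receiver.\<close>

lemma ex_theta:
  assumes n: "0 < n" and q: "0 \<le> q" "q \<le> 1/2" and \<beta>: "0 \<le> \<beta>" "\<beta> \<le> 1" and \<tau>: "0 \<le> \<tau>" "\<tau> \<le> 1"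
    and \<theta>: "0 \<le> \<theta>" "\<theta> \<le> 1/2" and half: "q = 1/2 \<Longrightarrow> \<theta> = 1/2"
    and le: "cond_ent q \<beta> \<tau> m n f \<le> real n * H2 (bstar \<theta> q)"
  obtains \<theta>' where "0 \<le> \<theta>'" "\<theta>' \<le> \<theta>" "cond_ent q \<beta> \<tau> m n f = real n * H2 (bstar \<theta>' q)"
    "q = 1/2 \<Longrightarrow> \<theta>' = 1/2"
proof (cases "q = 1/2")
  case True
  have "cond_ent q \<beta> \<tau> m n f = real n"
    using le cond_ent_ge [of q \<beta> \<tau> n m f] q \<beta> \<tau> by (simp add: True half [OF True] H2_half)
  then show ?thesis
    using that [of "1/2"] half [OF True] by (simp add: True H2_half)
next
  case False
  have "\<exists>x\<ge>0. x \<le> \<theta> \<and> real n * H2 (bstar x q) = cond_ent q \<beta> \<tau> m n f"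
  proof (rule IVT')
    show "real n * H2 (bstar 0 q) \<le> cond_ent q \<beta> \<tau> m n f"
      using cond_ent_ge [of q \<beta> \<tau> n m f] q \<beta> \<tau> by simp
    show "continuous_on {0..\<theta>} (\<lambda>x. real n * H2 (bstar x q))"
      using q \<theta> by (intro continuous_intros bstar_nonneg bstar_le_1) auto
  qed (use le \<theta> in auto)
  then show ?thesis using that False by metis
qed

lemma ex_theta_chain:
  assumes n: "0 < n" and K: "1 \<le> K"
    and p: "\<And>k. k \<in> {1..K} \<Longrightarrow> 0 \<le> p k \<and> p k \<le> 1/2" "\<And>k. k \<in> {1..<K} \<Longrightarrow> p (Suc k) \<le> p k"
    and \<beta>: "\<And>k. k \<in> {1..K} \<Longrightarrow> 0 \<le> \<beta> k \<and> \<beta> k \<le> 1/2" "\<And>k. k \<in> {1..<K} \<Longrightarrow> \<beta> (Suc k) \<le> \<beta> k"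
    and \<tau>: "\<tau> 0 = 1/2" "\<tau> K = 0" "\<And>k. k \<le> K \<Longrightarrow> 0 \<le> \<tau> k \<and> \<tau> k \<le> 1/2"
      "\<And>k. k < K \<Longrightarrow> \<tau> (Suc k) \<le> \<tau> k"
  obtains \<theta> :: "nat \<Rightarrow> real" where "\<theta> 0 = 1/2" "\<theta> K = 0" "\<And>k. k \<le> K \<Longrightarrow> 0 \<le> \<theta> k \<and> \<theta> k \<le> 1/2"
    "\<And>k. k < K \<Longrightarrow> \<theta> (Suc k) \<le> \<theta> k"
    "\<And>k. k < K \<Longrightarrow>
      cond_ent (p (Suc k)) (\<beta> (Suc k)) (\<tau> k) m n f - cond_ent (p (Suc k)) (\<beta> (Suc k)) (\<tau> (Suc k)) m n f
      \<le> real n * (H2 (bstar (\<theta> k) (p (Suc k))) - H2 (bstar (\<theta> (Suc k)) (p (Suc k))))"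
proof -
  define E where "E = (\<lambda>k t. cond_ent (p k) (\<beta> k) t m n f)"
  \<comment> \<open>The recursion invariant. The clause for crossover \<open>1/2\<close> exempts the
    last receiver, where \<open>\<theta> K = 0\<close> is prescribed in any case.\<close>
  define ok where "ok = (\<lambda>\<theta> k. 0 \<le> \<theta> (Suc k) \<and> \<theta> (Suc k) \<le> \<theta> k \<and>
    E (Suc k) (\<tau> k) \<le> real n * H2 (bstar (\<theta> k) (p (Suc k))) \<and>
    E (Suc k) (\<tau> (Suc k)) = real n * H2 (bstar (\<theta> (Suc k)) (p (Suc k))) \<and>
    (p (Suc k) = 1/2 \<longrightarrow> Suc k < K \<longrightarrow> \<theta> (Suc k) = 1/2))"
  have step: "\<exists>x. ok (\<theta>(Suc j := x)) j \<and> (Suc j = K \<longrightarrow> x = 0)"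
    if j: "j < K" and \<theta>0: "\<theta> 0 = 1/2" and prev: "\<forall>k<j. ok \<theta> k" for \<theta> :: "nat \<Rightarrow> real" and j
  proof -
    have \<theta>j: "0 \<le> \<theta> j \<and> \<theta> j \<le> 1/2"
    proof -
      have "i \<le> j \<Longrightarrow> 0 \<le> \<theta> i \<and> \<theta> i \<le> 1/2" for i
      proof (induction i)
        case (Suc i)
        then have "ok \<theta> i" using prev by simp
        with Suc show ?case by (auto simp: ok_def)
      qed (simp add: \<theta>0)
      then show ?thesis by simp
    qed
    have P: "0 \<le> p (Suc j) \<and> p (Suc j) \<le> 1/2" and B: "0 \<le> \<beta> (Suc j) \<and> \<beta> (Suc j) \<le> 1/2"
      using p(1) [of "Suc j"] \<beta>(1) [of "Suc j"] j by auto
    have T: "0 \<le> \<tau> j \<and> \<tau> j \<le> 1/2" "0 \<le> \<tau> (Suc j) \<and> \<tau> (Suc j) \<le> 1/2" "\<tau> (Suc j) \<le> \<tau> j"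
      using \<tau> j by auto
    have half: "\<theta> j = 1/2" if "p (Suc j) = 1/2"
    proof (cases j)
      case (Suc i)
      have "p (Suc j) \<le> p j" "p j \<le> 1/2" using p(1) [of j] p(2) [of j] j Suc by simp_all
      then have "p j = 1/2" using that by linarith
      moreover have "ok \<theta> i" using prev Suc by simp
      then have "p j = 1/2 \<longrightarrow> j < K \<longrightarrow> \<theta> j = 1/2" unfolding ok_def Suc by (elim conjE)
      ultimately show ?thesis using j by (elim impE) simp_all
    qed (simp add: \<theta>0)
    have bound: "E (Suc j) (\<tau> j) \<le> real n * H2 (bstar (\<theta> j) (p (Suc j)))"
    proof (cases j)
      \<comment> \<open>As \<open>\<theta> 0 = 1/2\<close>, the right side is \<open>n\<close>, the
        trivial bound on an entropy of \<open>n\<close> bits.\<close>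
      case 0
      then show ?thesis
        using cond_ent_le [of "p (Suc j)" "\<beta> (Suc j)" "\<tau> j" m n f] P B T
        by (simp add: E_def \<theta>0 H2_half)
    next
      case (Suc i)
      have pj: "p (Suc j) \<le> p j" "p j \<le> 1/2" "\<beta> (Suc j) \<le> \<beta> j" "\<beta> j \<le> 1/2"
        using p(1) [of j] p(2) [of j] \<beta>(1) [of j] \<beta>(2) [of j] j Suc by auto
      have "ok \<theta> i" using prev Suc by auto
      then have "E j (\<tau> j) = real n * H2 (bstar (\<theta> j) (p j))" "p j = 1/2 \<Longrightarrow> \<theta> j = 1/2"
        using j unfolding ok_def Suc by simp_all
      then have okj: "cond_ent (p j) (\<beta> j) (\<tau> j) m n f \<le> real n * H2 (bstar (\<theta> j) (p j))"
          "p j = 1/2 \<Longrightarrow> \<theta> j = 1/2"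
        unfolding E_def by simp_all
      show ?thesis
        unfolding E_def
        by (rule Mrs_Gerber_step [OF n P [THEN conjunct1] pj(1,2) B [THEN conjunct1] pj(3,4)
              T(1) [THEN conjunct1] T(1) [THEN conjunct2] \<theta>j [THEN conjunct1] \<theta>j [THEN conjunct2] okj])
    qed
    have "E (Suc j) (\<tau> (Suc j)) \<le> E (Suc j) (\<tau> j)"
      unfolding E_def using P B T by (intro cond_ent_mono_tau) auto
    with bound have bound': "E (Suc j) (\<tau> (Suc j)) \<le> real n * H2 (bstar (\<theta> j) (p (Suc j)))" by simp
    \<comment> \<open>The last receiver has \<open>\<tau> K = 0\<close>, so
      \<open>cond_ent_0\<close> gives the required equation with the witness 0; otherwise the
      witness comes from \<open>ex_theta\<close>.\<close>
    show ?thesis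
    proof (cases "Suc j = K")
      case True
      then have "E (Suc j) (\<tau> (Suc j)) = real n * H2 (bstar 0 (p (Suc j)))"
        unfolding E_def using P B \<tau>(2) by (simp add: cond_ent_0)
      then show ?thesis
        using True \<theta>j bound unfolding ok_def by (intro exI [of _ 0]) simp
    next
      case False
      have le1: "\<beta> (Suc j) \<le> 1" "\<tau> (Suc j) \<le> 1" using B T(2) by linarith+
      obtain x where x: "0 \<le> x" "x \<le> \<theta> j" "E (Suc j) (\<tau> (Suc j)) = real n * H2 (bstar x (p (Suc j)))"
        "p (Suc j) = 1/2 \<Longrightarrow> x = 1/2"
        using ex_theta [OF n P [THEN conjunct1] P [THEN conjunct2] B [THEN conjunct1] le1(1)
            T(2) [THEN conjunct1] le1(2) \<theta>j [THEN conjunct1] \<theta>j [THEN conjunct2] _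
            bound' [unfolded E_def]] half
        unfolding E_def by blast
      have "ok (\<theta>(Suc j := x)) j"
        unfolding ok_def using x bound by simp
      with False show ?thesis by blast
    qed
  qed
  have "\<exists>\<theta>. \<theta> 0 = 1/2 \<and> (\<forall>k<j. ok \<theta> k) \<and> (j = K \<longrightarrow> \<theta> K = 0)" if "j \<le> K" for j
    using that
  proof (induction j)
    case 0
    show ?case using K by (intro exI [of _ "\<lambda>_. 1/2"]) simp
  next
    case (Suc j)
    then have j: "j < K" by simp
    obtain \<theta> where \<theta>: "\<theta> 0 = 1/2" "\<forall>k<j. ok \<theta> k" using Suc.IH j by (meson less_imp_le)
    obtain x where x: "ok (\<theta>(Suc j := x)) j" "Suc j = K \<longrightarrow> x = 0"
      using step [OF j \<theta>] by (elim exE conjE)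
    have "ok (\<theta>(Suc j := x)) k" if "k < j" for k
    proof -
      have "(\<theta>(Suc j := x)) k = \<theta> k" "(\<theta>(Suc j := x)) (Suc k) = \<theta> (Suc k)" using that by simp_all
      moreover have "ok \<theta> k" using \<theta>(2) that by simp
      ultimately show ?thesis unfolding ok_def by auto
    qed
    then have "\<forall>k<Suc j. ok (\<theta>(Suc j := x)) k" using x(1) less_Suc_eq by metis
    moreover have "(\<theta>(Suc j := x)) 0 = 1/2" using \<theta>(1) by simp
    moreover have "Suc j = K \<longrightarrow> (\<theta>(Suc j := x)) K = 0" using x(2) by auto
    ultimately show ?case by blast
  qed
  from this [OF order.refl] obtain \<theta> where \<theta>: "\<theta> 0 = 1/2" "\<forall>k<K. ok \<theta> k" "\<theta> K = 0" by (elim exE conjE) simp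
  have dec: "0 \<le> \<theta> (Suc k)" "\<theta> (Suc k) \<le> \<theta> k" if "k < K" for k
    using \<theta>(2) that unfolding ok_def by simp_all
  show ?thesis
  proof (rule that [OF \<theta>(1,3) _ dec(2)])
    show "0 \<le> \<theta> k \<and> \<theta> k \<le> 1/2" if "k \<le> K" for k
      using that
    proof (induction k)
      case (Suc k)
      then show ?case using dec [of k] by simp
    qed (simp add: \<theta>)
    fix k assume "k < K"
    then have "E (Suc k) (\<tau> k) \<le> real n * H2 (bstar (\<theta> k) (p (Suc k)))"
      "E (Suc k) (\<tau> (Suc k)) = real n * H2 (bstar (\<theta> (Suc k)) (p (Suc k)))"
      using \<theta>(2) unfolding ok_def by simp_all
    then show "cond_ent (p (Suc k)) (\<beta> (Suc k)) (\<tau> k) m n f - cond_ent (p (Suc k)) (\<beta> (Suc k)) (\<tau> (Suc k)) m n f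
      \<le> real n * (H2 (bstar (\<theta> k) (p (Suc k))) - H2 (bstar (\<theta> (Suc k)) (p (Suc k))))"
      unfolding E_def by (simp add: right_diff_distrib)
  qed
qed

section \<open>Passage to the limit\<close>

lemma ex_convergent_subseq:
  fixes x :: "nat \<Rightarrow> nat \<Rightarrow> real"
  assumes "\<And>j k. k < N \<Longrightarrow> a \<le> x j k \<and> x j k \<le> c"
  obtains r l where "strict_mono r" "\<And>k. k < N \<Longrightarrow> (\<lambda>j. x (r j) k) \<longlonglongrightarrow> l k"
proof -
  have "\<exists>r l. strict_mono r \<and> (\<forall>k<N. (\<lambda>j. x (r j) k) \<longlonglongrightarrow> l k)"
    using assms
  proof (induction N)
    case 0
    show ?case by (intro exI [of _ id]) (simp add: strict_mono_def)
  next
    case (Suc N)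
    have "\<exists>r l. strict_mono r \<and> (\<forall>k<N. (\<lambda>j. x (r j) k) \<longlonglongrightarrow> l k)"
      by (rule Suc.IH) (use Suc.prems in simp)
    then obtain r l where r: "strict_mono r" "\<forall>k<N. (\<lambda>j. x (r j) k) \<longlonglongrightarrow> l k"
      by (elim exE conjE)
    have "\<forall>j. x (r j) N \<in> {a..c}" using Suc.prems by simp
    then obtain l' r' where r': "strict_mono r'" "((\<lambda>j. x (r j) N) \<circ> r') \<longlonglongrightarrow> l'"
      using seq_compactE [OF compact_imp_seq_compact [OF compact_Icc]] by metis
    have "(\<lambda>j. x (r (r' j)) k) \<longlonglongrightarrow> l k" if "k < N" for k
      using LIMSEQ_subseq_LIMSEQ [OF r(2) [rule_format, OF that] r'(1)] by (simp add: comp_def)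
    then show ?case
      using r'(2) strict_mono_o [OF r(1) r'(1)]
      by (intro exI [of _ "r \<circ> r'"] exI [of _ "l(N := l')"]) (auto simp: comp_def less_Suc_eq)
  qed
  then show ?thesis using that by blast
qed

definition info_gain :: "real \<Rightarrow> real \<Rightarrow> real \<Rightarrow> real \<Rightarrow> real" where
  "info_gain \<alpha> \<beta> \<tau> \<tau>' = H2 (bstar \<beta> \<tau>) - H2 (bstar \<beta> \<tau>') - (H4 \<alpha> \<beta> \<tau> - H4 \<alpha> \<beta> \<tau>')"

text \<open>Among laws of mass 1 the uniform one minimizes \<open>equivocation_gap\<close>, and
  \<open>info_gain\<close> is the excess over that minimum. It ensures that the rates are
  nonnegative, as \<open>C_BBC\<close> demands.\<close>

lemma info_gain_nonneg:
  assumes "0 \<le> \<alpha>" "\<alpha> \<le> 1" "0 \<le> \<beta>" "\<beta> \<le> 1" "0 \<le> \<tau>" "\<tau> \<le> \<tau>'" "\<tau>' \<le> 1/2"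
  shows "0 \<le> info_gain \<alpha> \<beta> \<tau> \<tau>'"
proof -
  obtain \<delta> where \<delta>: "0 \<le> \<delta>" "\<delta> \<le> 1/2" "\<tau>' = bstar \<tau> \<delta>"
    by (rule ex_bstar_factor [OF assms(5-7)])
  have "(bk \<alpha> False True + bk \<alpha> False False) * equivocation_gap \<beta> \<tau> \<delta> (bk (1/2) False)
      \<le> equivocation_gap \<beta> \<tau> \<delta> (bk \<alpha> False)"
    using assms \<delta> by (intro sublinear_symmetric_ge equivocation_gap_sublinear bk_nonneg) auto
  then show ?thesis
    using assms unfolding equivocation_gap_bk \<delta>(3) [symmetric]
    by (simp add: info_gain_def H4_half bk_def)
qed

lemma continuous_on_H4:
  assumes "0 \<le> \<beta>" "\<beta> \<le> 1" "0 \<le> \<tau>" "\<tau> \<le> 1"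
  shows "continuous_on {0..1} (\<lambda>\<alpha>. H4 \<alpha> \<beta> \<tau>)"
  unfolding H4_def using assms
  by (intro continuous_intros add_nonneg_nonneg mult_nonneg_nonneg) auto

text \<open>The strict inequality keeps the denominators away from 0; at \<open>a = \<beta>\<close>
  the function \<open>eta\<close> can be discontinuous.\<close>

lemma tendsto_eta:
  assumes \<alpha>: "\<alpha> \<longlonglongrightarrow> a" and D: "D \<longlonglongrightarrow> E" and "a < \<beta>"
  shows "(\<lambda>j. eta (\<alpha> j) \<beta> (D j)) \<longlonglongrightarrow> eta a \<beta> E"
proof -
  have "\<forall>\<^sub>F j in sequentially. \<alpha> j < \<beta>" using order_tendstoD(2) [OF \<alpha> \<open>a < \<beta>\<close>] .
  then have "\<forall>\<^sub>F j in sequentially. (\<beta> - D j) / (\<beta> - \<alpha> j) = eta (\<alpha> j) \<beta> (D j)"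
    by eventually_elim (simp add: eta_def)
  moreover have "(\<lambda>j. (\<beta> - D j) / (\<beta> - \<alpha> j)) \<longlonglongrightarrow> eta a \<beta> E"
    using \<open>a < \<beta>\<close> by (auto simp: eta_def intro!: tendsto_intros \<alpha> D)
  ultimately show ?thesis by (rule Lim_transform_eventually [rotated])
qed

lemma eta_antimono: "D \<le> D' \<Longrightarrow> eta \<alpha> \<beta> D' \<le> eta \<alpha> \<beta> D"
  by (simp add: eta_def divide_right_mono)

lemma eta_nonneg: "D \<le> \<beta> \<Longrightarrow> 0 \<le> eta \<alpha> \<beta> D"
  by (simp add: eta_def)

text \<open>The bound for one code, before any limit, with its actual distortions \<open>d\<close>.
  \<open>\<alpha>\<close> is fixed before \<open>\<tau>\<close> is quantified, while
  \<open>\<theta>\<close> may depend on \<open>\<tau>\<close>.\<close>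

lemma code_outer_bound:
  assumes K: "1 \<le> K" and b: "0 < b" and m: "0 < m" "real n = b * real m"
    and p: "\<And>k. k \<in> {1..K} \<Longrightarrow> 0 \<le> p k \<and> p k \<le> 1/2" "\<And>k. k \<in> {1..<K} \<Longrightarrow> p (Suc k) \<le> p k"
    and \<beta>: "\<And>k. k \<in> {1..K} \<Longrightarrow> 0 \<le> \<beta> k \<and> \<beta> k \<le> 1/2" "\<And>k. k \<in> {1..<K} \<Longrightarrow> \<beta> (Suc k) \<le> \<beta> k"
    and d: "\<And>k. k \<in> {1..K} \<Longrightarrow> d k = (1 / real m) * (\<Sum>t<m. err_prob (p k) (\<beta> k) m n f (g k) t)"
  obtains \<alpha> :: "nat \<Rightarrow> real" where "\<And>k. k \<in> {1..K} \<Longrightarrow> 0 \<le> \<alpha> k \<and> \<alpha> k \<le> d k \<and> \<alpha> k \<le> \<beta> k"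
    "\<And>\<tau> :: nat \<Rightarrow> real. \<lbrakk>\<tau> 0 = 1/2; \<tau> K = 0; \<And>k. k \<le> K \<Longrightarrow> 0 \<le> \<tau> k \<and> \<tau> k \<le> 1/2; \<And>k. k < K \<Longrightarrow> \<tau> (Suc k) \<le> \<tau> k\<rbrakk>
      \<Longrightarrow> \<exists>\<theta> :: nat \<Rightarrow> real. \<theta> 0 = 1/2 \<and> \<theta> K = 0 \<and> (\<forall>k\<le>K. 0 \<le> \<theta> k \<and> \<theta> k \<le> 1/2) \<and>
        (\<forall>k<K. \<theta> (Suc k) \<le> \<theta> k \<and>
          (1 / b) * (eta (\<alpha> (Suc k)) (\<beta> (Suc k)) (min (d (Suc k)) (\<beta> (Suc k))) *
            info_gain (\<alpha> (Suc k)) (\<beta> (Suc k)) (\<tau> (Suc k)) (\<tau> k))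
          \<le> H2 (bstar (\<theta> k) (p (Suc k))) - H2 (bstar (\<theta> (Suc k)) (p (Suc k))))"
proof -
  have n: "0 < n" using b m by (metis mult_pos_pos of_nat_0_less_iff)
  have "\<exists>a. 0 \<le> a \<and> a \<le> d k \<and> a \<le> \<beta> k \<and> (\<forall>\<tau> \<tau>'. 0 \<le> \<tau> \<longrightarrow> \<tau> \<le> \<tau>' \<longrightarrow> \<tau>' \<le> 1/2 \<longrightarrow>
      real m * (eta a (\<beta> k) (min (d k) (\<beta> k)) * info_gain a (\<beta> k) \<tau> \<tau>')
        \<le> cond_ent (p k) (\<beta> k) \<tau>' m n f - cond_ent (p k) (\<beta> k) \<tau> m n f)"
    if k: "k \<in> {1..K}" for k
  proof -
    have "0 \<le> p k" "p k \<le> 1" "0 \<le> \<beta> k" "\<beta> k \<le> 1/2" using p(1) [OF k] \<beta>(1) [OF k] by auto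
    from source_converse [OF this m(1) d [OF k]]
    obtain a where "0 \<le> a" "a \<le> d k" "a \<le> \<beta> k" and "\<And>\<tau> \<tau>'. \<lbrakk>0 \<le> \<tau>; \<tau> \<le> \<tau>'; \<tau>' \<le> 1/2\<rbrakk> \<Longrightarrow>
      real m * (eta a (\<beta> k) (min (d k) (\<beta> k)) *
        (H2 (bstar (\<beta> k) \<tau>) - H2 (bstar (\<beta> k) \<tau>') - (H4 a (\<beta> k) \<tau> - H4 a (\<beta> k) \<tau>')))
      \<le> cond_ent (p k) (\<beta> k) \<tau>' m n f - cond_ent (p k) (\<beta> k) \<tau> m n f" by blast
    then show ?thesis
      unfolding info_gain_def by (intro exI [of _ a] conjI allI impI) assumption+
  qed
  then have "\<forall>k\<in>{1..K}. \<exists>a. 0 \<le> a \<and> a \<le> d k \<and> a \<le> \<beta> k \<and> (\<forall>\<tau> \<tau>'. 0 \<le> \<tau> \<longrightarrow> \<tau> \<le> \<tau>' \<longrightarrow> \<tau>' \<le> 1/2 \<longrightarrow>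
      real m * (eta a (\<beta> k) (min (d k) (\<beta> k)) * info_gain a (\<beta> k) \<tau> \<tau>')
        \<le> cond_ent (p k) (\<beta> k) \<tau>' m n f - cond_ent (p k) (\<beta> k) \<tau> m n f)" ..
  from bchoice [OF this] obtain \<alpha> where A: "\<forall>k\<in>{1..K}. 0 \<le> \<alpha> k \<and> \<alpha> k \<le> d k \<and> \<alpha> k \<le> \<beta> k \<and>
      (\<forall>\<tau> \<tau>'. 0 \<le> \<tau> \<longrightarrow> \<tau> \<le> \<tau>' \<longrightarrow> \<tau>' \<le> 1/2 \<longrightarrow>
      real m * (eta (\<alpha> k) (\<beta> k) (min (d k) (\<beta> k)) * info_gain (\<alpha> k) (\<beta> k) \<tau> \<tau>')
        \<le> cond_ent (p k) (\<beta> k) \<tau>' m n f - cond_ent (p k) (\<beta> k) \<tau> m n f)" ..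
  have \<alpha>: "0 \<le> \<alpha> k \<and> \<alpha> k \<le> d k \<and> \<alpha> k \<le> \<beta> k" if "k \<in> {1..K}" for k
    using A that by blast
  have gain: "real m * (eta (\<alpha> k) (\<beta> k) (min (d k) (\<beta> k)) * info_gain (\<alpha> k) (\<beta> k) \<tau> \<tau>')
        \<le> cond_ent (p k) (\<beta> k) \<tau>' m n f - cond_ent (p k) (\<beta> k) \<tau> m n f"
    if "k \<in> {1..K}" "0 \<le> \<tau>" "\<tau> \<le> \<tau>'" "\<tau>' \<le> 1/2" for k \<tau> \<tau>'
    using A that by blast
  show ?thesis
  proof (rule that [OF \<alpha>])
    fix \<tau> :: "nat \<Rightarrow> real"
    assume \<tau>: "\<tau> 0 = 1/2" "\<tau> K = 0" "\<And>k. k \<le> K \<Longrightarrow> 0 \<le> \<tau> k \<and> \<tau> k \<le> 1/2"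
      "\<And>k. k < K \<Longrightarrow> \<tau> (Suc k) \<le> \<tau> k"
    obtain \<theta> :: "nat \<Rightarrow> real" where \<theta>: "\<theta> 0 = 1/2" "\<theta> K = 0" "\<And>k. k \<le> K \<Longrightarrow> 0 \<le> \<theta> k \<and> \<theta> k \<le> 1/2"
      "\<And>k. k < K \<Longrightarrow> \<theta> (Suc k) \<le> \<theta> k"
      "\<And>k. k < K \<Longrightarrow>
        cond_ent (p (Suc k)) (\<beta> (Suc k)) (\<tau> k) m n f - cond_ent (p (Suc k)) (\<beta> (Suc k)) (\<tau> (Suc k)) m n f
        \<le> real n * (H2 (bstar (\<theta> k) (p (Suc k))) - H2 (bstar (\<theta> (Suc k)) (p (Suc k))))"
      using ex_theta_chain [where p = p and \<beta> = \<beta> and \<tau> = \<tau> and m = m and f = f, OF n K p \<beta> \<tau>] by blast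
    have "(1 / b) * (eta (\<alpha> (Suc k)) (\<beta> (Suc k)) (min (d (Suc k)) (\<beta> (Suc k))) *
            info_gain (\<alpha> (Suc k)) (\<beta> (Suc k)) (\<tau> (Suc k)) (\<tau> k))
          \<le> H2 (bstar (\<theta> k) (p (Suc k))) - H2 (bstar (\<theta> (Suc k)) (p (Suc k)))" (is "(1 / b) * ?x \<le> ?y")
      if k: "k < K" for k
    proof -
      have "real m * ?x \<le> real n * ?y"
        using gain [of "Suc k" "\<tau> (Suc k)" "\<tau> k"] \<theta>(5) [OF k] \<tau>(3) [of k] \<tau>(3) [of "Suc k"] \<tau>(4) [OF k] k
        by simp
      then have "real m * ?x \<le> real m * (b * ?y)" by (simp only: m(2) mult_ac)
      then have "?x \<le> b * ?y" using m(1) by simp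
      then show ?thesis using b by (simp add: field_simps)
    qed
    then show "\<exists>\<theta> :: nat \<Rightarrow> real. \<theta> 0 = 1/2 \<and> \<theta> K = 0 \<and> (\<forall>k\<le>K. 0 \<le> \<theta> k \<and> \<theta> k \<le> 1/2) \<and>
        (\<forall>k<K. \<theta> (Suc k) \<le> \<theta> k \<and>
          (1 / b) * (eta (\<alpha> (Suc k)) (\<beta> (Suc k)) (min (d (Suc k)) (\<beta> (Suc k))) *
            info_gain (\<alpha> (Suc k)) (\<beta> (Suc k)) (\<tau> (Suc k)) (\<tau> k))
          \<le> H2 (bstar (\<theta> k) (p (Suc k))) - H2 (bstar (\<theta> (Suc k)) (p (Suc k))))"
      using \<theta>(1-4) by blast
  qed
qed

lemma antitone_interval:
  fixes f :: "nat \<Rightarrow> real"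
  assumes "\<forall>k\<in>{a..<K}. f (k + 1) \<le> f k" "a \<le> i" "i \<le> j" "j \<le> K"
  shows "f j \<le> f i"
  using assms(3,4)
proof (induction j rule: dec_induct)
  case (step j)
  then have "f (j + 1) \<le> f j" using assms(1,2) by simp
  with step show ?case by simp
qed simp

lemma tendsto_info_gain:
  assumes "0 \<le> \<beta>" "\<beta> \<le> 1" "0 \<le> \<tau>" "\<tau> \<le> 1" "0 \<le> \<tau>'" "\<tau>' \<le> 1"
    and "\<alpha> \<longlonglongrightarrow> a" "a \<in> {0..1}" "\<And>j. \<alpha> j \<in> {0..1}"
  shows "(\<lambda>j. info_gain (\<alpha> j) \<beta> \<tau> \<tau>') \<longlonglongrightarrow> info_gain a \<beta> \<tau> \<tau>'"
proof -
  have "(\<lambda>j. H4 (\<alpha> j) \<beta> t) \<longlonglongrightarrow> H4 a \<beta> t" if "0 \<le> t" "t \<le> 1" for t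
    by (rule continuous_on_tendsto_compose [OF continuous_on_H4 assms(7,8)])
      (use assms that in auto)
  then show ?thesis
    unfolding info_gain_def using assms by (intro tendsto_diff tendsto_const) auto
qed

lemma tendsto_H2_bstar:
  assumes "0 \<le> q" "q \<le> 1" "x \<longlonglongrightarrow> l" "l \<in> {0..1}" "\<And>j. x j \<in> {0..1}"
  shows "(\<lambda>j. H2 (bstar (x j) q)) \<longlonglongrightarrow> H2 (bstar l q)"
proof (rule continuous_on_tendsto_compose [OF _ assms(3,4)])
  show "continuous_on {0..1} (\<lambda>x. H2 (bstar x q))"
    using assms by (intro continuous_intros bstar_nonneg bstar_le_1) auto
qed (use assms in auto)

text \<open>Only an upper bound on the limsup is known, so the distortions need not converge.
  Raising them to at least \<open>D\<close> produces convergence, and since \<open>eta\<close> is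
  antitone in the distortion this merely weakens the bounds.\<close>

lemma tendsto_max_of_limsup_le:
  assumes "limsup (\<lambda>j. ereal (d j)) \<le> ereal D"
  shows "(\<lambda>j. max (d j) D) \<longlonglongrightarrow> D"
proof (rule LIMSEQ_I)
  fix e :: real assume "0 < e"
  then have "\<forall>\<^sub>F j in sequentially. ereal (d j) < ereal (D + e)"
    using assms [unfolded Limsup_le_iff, rule_format, of "ereal (D + e)"] by simp
  then obtain N where N: "\<And>j. N \<le> j \<Longrightarrow> d j < D + e"
    unfolding eventually_sequentially by auto
  have "norm (max (d j) D - D) < e" if "N \<le> j" for j
    using N [OF that] \<open>0 < e\<close> by (simp add: max_def)
  then show "\<exists>N. \<forall>j\<ge>N. norm (max (d j) D - D) < e" by blast
qed

theorem theorem9: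
  fixes K :: nat and b :: real and p \<beta> D :: "nat \<Rightarrow> real"
  assumes "1 \<le> K" and "0 < b"
    and "p 1 \<le> 1/2" and "\<forall>k\<in>{1..<K}. p (k + 1) \<le> p k" and "0 \<le> p K"
    and "\<beta> 1 \<le> 1/2" and "\<forall>k\<in>{1..<K}. \<beta> (k + 1) \<le> \<beta> k" and "0 \<le> \<beta> K"
    and "achievable_SI K b p \<beta> D"
  shows "R_SI_D_outer K b p \<beta> D"
proof -
  have p: "0 \<le> p k \<and> p k \<le> 1/2" if "k \<in> {1..K}" for k
    using antitone_interval [OF assms(4), of 1 k] antitone_interval [OF assms(4), of k K] assms(3,5) that
    by auto
  have \<beta>: "0 \<le> \<beta> k \<and> \<beta> k \<le> 1/2" if "k \<in> {1..K}" for k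
    using antitone_interval [OF assms(7), of 1 k] antitone_interval [OF assms(7), of k K] assms(6,8) that
    by auto
  obtain ms ns :: "nat \<Rightarrow> nat" and f g where
    ms: "\<And>j. 0 < ms j" "\<And>j. real (ns j) = b * real (ms j)" and
    lim: "\<And>k. k \<in> {1..K} \<Longrightarrow> limsup (\<lambda>j. ereal ((1 / real (ms j)) *
        (\<Sum>t<ms j. err_prob (p k) (\<beta> k) (ms j) (ns j) (f j) (g j k) t))) \<le> ereal (D k)"
    using assms(9) unfolding achievable_SI_def by blast
  define d where "d = (\<lambda>j k. (1 / real (ms j)) *
        (\<Sum>t<ms j. err_prob (p k) (\<beta> k) (ms j) (ns j) (f j) (g j k) t))"
  define good where "good = (\<lambda>j \<alpha> \<tau> \<theta>. \<theta> 0 = 1/2 \<and> \<theta> K = 0 \<and> (\<forall>k\<le>K. 0 \<le> \<theta> k \<and> \<theta> k \<le> 1/2) \<and>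
    (\<forall>k<K. \<theta> (Suc k) \<le> \<theta> k \<and>
      (1 / b) * (eta (\<alpha> (Suc k)) (\<beta> (Suc k)) (min (d j (Suc k)) (\<beta> (Suc k))) *
        info_gain (\<alpha> (Suc k)) (\<beta> (Suc k)) (\<tau> (Suc k)) (\<tau> k))
      \<le> H2 (bstar (\<theta> k) (p (Suc k))) - H2 (bstar (\<theta> (Suc k)) (p (Suc k)))))"
  define mono where "mono = (\<lambda>\<tau> :: nat \<Rightarrow> real. \<tau> 0 = 1/2 \<and> \<tau> K = 0 \<and> (\<forall>k\<le>K. 0 \<le> \<tau> k \<and> \<tau> k \<le> 1/2) \<and>
    (\<forall>k<K. \<tau> (Suc k) \<le> \<tau> k))"
  have "\<exists>\<alpha>. (\<forall>k\<in>{1..K}. 0 \<le> \<alpha> k \<and> \<alpha> k \<le> d j k \<and> \<alpha> k \<le> \<beta> k) \<and>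
      (\<forall>\<tau>. mono \<tau> \<longrightarrow> (\<exists>\<theta> :: nat \<Rightarrow> real. good j \<alpha> \<tau> \<theta>))" for j
  proof -
    have S: "p (Suc k) \<le> p k" "\<beta> (Suc k) \<le> \<beta> k" if "k \<in> {1..<K}" for k
      using assms(4,7) that by auto
    show ?thesis
    proof (rule code_outer_bound [where p = p and \<beta> = \<beta> and d = "d j" and f = "f j" and g = "g j",
          OF assms(1,2) ms(1) [of j] ms(2) [of j] p S(1) \<beta> S(2)])
      show "d j k = 1 / real (ms j) * (\<Sum>t<ms j. err_prob (p k) (\<beta> k) (ms j) (ns j) (f j) (g j k) t)" for k
        by (simp add: d_def)
      fix \<alpha> :: "nat \<Rightarrow> real"
      assume 1: "\<And>k. k \<in> {1..K} \<Longrightarrow> 0 \<le> \<alpha> k \<and> \<alpha> k \<le> d j k \<and> \<alpha> k \<le> \<beta> k"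
        and 2: "\<And>\<tau> :: nat \<Rightarrow> real. \<lbrakk>\<tau> 0 = 1/2; \<tau> K = 0; \<And>k. k \<le> K \<Longrightarrow> 0 \<le> \<tau> k \<and> \<tau> k \<le> 1/2; \<And>k. k < K \<Longrightarrow> \<tau> (Suc k) \<le> \<tau> k\<rbrakk>
          \<Longrightarrow> \<exists>\<theta> :: nat \<Rightarrow> real. \<theta> 0 = 1/2 \<and> \<theta> K = 0 \<and> (\<forall>k\<le>K. 0 \<le> \<theta> k \<and> \<theta> k \<le> 1/2) \<and>
          (\<forall>k<K. \<theta> (Suc k) \<le> \<theta> k \<and>
            (1 / b) * (eta (\<alpha> (Suc k)) (\<beta> (Suc k)) (min (d j (Suc k)) (\<beta> (Suc k))) *
              info_gain (\<alpha> (Suc k)) (\<beta> (Suc k)) (\<tau> (Suc k)) (\<tau> k))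
            \<le> H2 (bstar (\<theta> k) (p (Suc k))) - H2 (bstar (\<theta> (Suc k)) (p (Suc k))))"
      have "\<exists>\<theta>. good j \<alpha> \<tau> \<theta>" if "mono \<tau>" for \<tau>
        unfolding good_def using that unfolding mono_def by (intro 2) blast+
      with 1 show ?thesis by blast
    qed auto
  qed
  then obtain A where A: "\<And>j k. k \<in> {1..K} \<Longrightarrow> 0 \<le> A j k \<and> A j k \<le> d j k \<and> A j k \<le> \<beta> k"
    and A_good: "\<And>j \<tau>. mono \<tau> \<Longrightarrow> \<exists>\<theta>. good j (A j) \<tau> \<theta>"
    by metis
  have A_bounds: "0 \<le> A j (Suc k) \<and> A j (Suc k) \<le> 1/2" if "k < K" for j k
    using A [of "Suc k" j] \<beta> [of "Suc k"] that by auto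
  \<comment> \<open>This subsequence is chosen before any \<open>\<tau>\<close> is given, so its
    limit serves all of them.\<close>
  obtain r l where r: "strict_mono r" and l: "\<And>k. k < K \<Longrightarrow> (\<lambda>j. A (r j) (Suc k)) \<longlonglongrightarrow> l k"
    using ex_convergent_subseq [of K 0 "\<lambda>j k. A j (Suc k)" "1/2", OF A_bounds] by blast
  have max_lim: "(\<lambda>j. max (d (r j) k) (D k)) \<longlonglongrightarrow> D k" if "k \<in> {1..K}" for k
    using LIMSEQ_subseq_LIMSEQ [OF tendsto_max_of_limsup_le [OF lim [OF that]] r]
    by (simp add: comp_def d_def)
  have l_bounds: "0 \<le> l k" "l k \<le> D (Suc k)" "l k \<le> \<beta> (Suc k)" if "k < K" for k
  proof -
    have k: "Suc k \<in> {1..K}" using that by simp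
    show "0 \<le> l k" by (rule LIMSEQ_le_const [OF l [OF that]]) (use A [OF k] in auto)
    show "l k \<le> \<beta> (Suc k)" by (rule LIMSEQ_le_const2 [OF l [OF that]]) (use A [OF k] in auto)
    have "A (r j) (Suc k) \<le> max (d (r j) (Suc k)) (D (Suc k))" for j
      using A [OF k, of "r j"] by (simp add: le_max_iff_disj)
    then show "l k \<le> D (Suc k)"
      by (intro LIMSEQ_le [OF l [OF that] max_lim [OF k]]) auto
  qed
  have final: "C_BBC K p (\<lambda>k. (1 / b) * (eta (l (k - 1)) (\<beta> k) (min (D k) (\<beta> k)) *
      info_gain (l (k - 1)) (\<beta> k) (\<tau> k) (\<tau> (k - 1))))" if \<tau>: "mono \<tau>" for \<tau>
  proof -
    have "\<forall>j. \<exists>\<theta>. good (r j) (A (r j)) \<tau> \<theta>" using A_good [OF \<tau>] by blast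
    then obtain \<Theta> where \<Theta>: "\<And>j. good (r j) (A (r j)) \<tau> (\<Theta> j)" by metis
    have \<Theta>b: "0 \<le> \<Theta> j k \<and> \<Theta> j k \<le> 1/2" if "k < Suc K" for j k
      using \<Theta> [of j] that unfolding good_def by simp
    \<comment> \<open>The further subsequence depends on \<open>\<tau>\<close>, which is harmless:
      it leaves the limits \<open>l\<close> unchanged, and \<open>\<theta>\<close> may depend on
      \<open>\<tau>\<close>.\<close>
    obtain r' \<theta> where r': "strict_mono r'" and \<theta>: "\<And>k. k < Suc K \<Longrightarrow> (\<lambda>j. \<Theta> (r' j) k) \<longlonglongrightarrow> \<theta> k"
      using ex_convergent_subseq [of "Suc K" 0 \<Theta> "1/2", OF \<Theta>b] by blast
    have \<theta>b: "0 \<le> \<theta> k" "\<theta> k \<le> 1/2" if "k < Suc K" for k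
      using LIMSEQ_le_const [OF \<theta> [OF that], of 0] LIMSEQ_le_const2 [OF \<theta> [OF that], of "1/2"] \<Theta>b [OF that]
      by auto
    have \<Theta>0K: "\<Theta> j 0 = 1/2" "\<Theta> j K = 0" for j
      using \<Theta> [of j] unfolding good_def by simp_all
    then have "(\<lambda>j. 1/2) \<longlonglongrightarrow> \<theta> 0" "(\<lambda>j. 0) \<longlonglongrightarrow> \<theta> K"
      using \<theta> [of 0] \<theta> [of K] by (simp_all only: \<Theta>0K)
    then have \<theta>0: "\<theta> 0 = 1/2" and \<theta>K: "\<theta> K = 0"
      by (auto dest: LIMSEQ_unique [OF _ tendsto_const])
    have main: "\<theta> (Suc k) \<le> \<theta> k \<and>
        0 \<le> (1 / b) * (eta (l k) (\<beta> (Suc k)) (min (D (Suc k)) (\<beta> (Suc k))) *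
          info_gain (l k) (\<beta> (Suc k)) (\<tau> (Suc k)) (\<tau> k)) \<and>
        (1 / b) * (eta (l k) (\<beta> (Suc k)) (min (D (Suc k)) (\<beta> (Suc k))) *
          info_gain (l k) (\<beta> (Suc k)) (\<tau> (Suc k)) (\<tau> k))
        \<le> H2 (bstar (\<theta> k) (p (Suc k))) - H2 (bstar (\<theta> (Suc k)) (p (Suc k)))" if k: "k < K" for k
    proof (intro conjI)
      let ?B = "\<beta> (Suc k)" and ?P = "p (Suc k)" and ?D = "D (Suc k)"
      have K': "Suc k \<in> {1..K}" using k by simp
      have B: "0 \<le> ?B" "?B \<le> 1/2" and P: "0 \<le> ?P" "?P \<le> 1/2" using \<beta> [OF K'] p [OF K'] by auto
      have T: "0 \<le> \<tau> (Suc k)" "\<tau> (Suc k) \<le> \<tau> k" "\<tau> k \<le> 1/2" using \<tau> k unfolding mono_def by simp_all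
      show "\<theta> (Suc k) \<le> \<theta> k"
        by (rule LIMSEQ_le [OF \<theta> \<theta>]) (use \<Theta> k in \<open>auto simp: good_def\<close>)
      have ig: "0 \<le> info_gain a ?B (\<tau> (Suc k)) (\<tau> k)" if "0 \<le> a" "a \<le> ?B" for a
        using that B T by (intro info_gain_nonneg) auto
      show "0 \<le> (1 / b) * (eta (l k) ?B (min ?D ?B) * info_gain (l k) ?B (\<tau> (Suc k)) (\<tau> k))"
        using assms(2) l_bounds [OF k] by (intro mult_nonneg_nonneg eta_nonneg ig) auto
      define a where "a = (\<lambda>j. A (r (r' j)) (Suc k))"
      define E where "E = (\<lambda>j. max (d (r (r' j)) (Suc k)) ?D)"
      have a: "0 \<le> a j" "a j \<le> ?B" for j using A [OF K'] by (auto simp: a_def)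
      have a_lim: "a \<longlonglongrightarrow> l k"
        using LIMSEQ_subseq_LIMSEQ [OF l [OF k] r'] by (simp add: a_def comp_def)
      have E_lim: "E \<longlonglongrightarrow> ?D"
        using LIMSEQ_subseq_LIMSEQ [OF max_lim [OF K'] r'] by (simp add: E_def comp_def)
      have rhs: "(\<lambda>j. H2 (bstar (\<Theta> (r' j) k) ?P) - H2 (bstar (\<Theta> (r' j) (Suc k)) ?P))
          \<longlonglongrightarrow> H2 (bstar (\<theta> k) ?P) - H2 (bstar (\<theta> (Suc k)) ?P)"
      proof (intro tendsto_diff tendsto_H2_bstar \<theta>)
        show "\<theta> k \<in> {0..1}" "\<theta> (Suc k) \<in> {0..1}"
          using \<theta>b [of k] \<theta>b [of "Suc k"] k by auto
        show "\<Theta> (r' j) k \<in> {0..1}" "\<Theta> (r' j) (Suc k) \<in> {0..1}" for j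
          using \<Theta>b [of k "r' j"] \<Theta>b [of "Suc k" "r' j"] k by auto
      qed (use P k in auto)
      have le: "(1 / b) * (eta (a j) ?B (min (E j) ?B) * info_gain (a j) ?B (\<tau> (Suc k)) (\<tau> k))
          \<le> H2 (bstar (\<Theta> (r' j) k) ?P) - H2 (bstar (\<Theta> (r' j) (Suc k)) ?P)" for j
      proof -
        have "(1 / b) * (eta (a j) ?B (min (E j) ?B) * info_gain (a j) ?B (\<tau> (Suc k)) (\<tau> k))
          \<le> (1 / b) * (eta (a j) ?B (min (d (r (r' j)) (Suc k)) ?B) * info_gain (a j) ?B (\<tau> (Suc k)) (\<tau> k))"
          using assms(2) a [of j] by (intro mult_left_mono mult_right_mono eta_antimono ig) (auto simp: E_def)
        also have "\<dots> \<le> H2 (bstar (\<Theta> (r' j) k) ?P) - H2 (bstar (\<Theta> (r' j) (Suc k)) ?P)"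
          using \<Theta> [of "r' j"] k unfolding good_def a_def by blast
        finally show ?thesis .
      qed
      show "(1 / b) * (eta (l k) ?B (min ?D ?B) * info_gain (l k) ?B (\<tau> (Suc k)) (\<tau> k))
          \<le> H2 (bstar (\<theta> k) ?P) - H2 (bstar (\<theta> (Suc k)) ?P)"
      \<comment> \<open>If \<open>l k\<close> reaches \<open>\<beta>\<close>, \<open>eta\<close>
        need not converge along the sequence. There the left side is 0, and the right side is a
        limit of upper bounds on nonnegative rates.\<close>
      proof (cases "l k < ?B")
        case True
        have ig_lim: "(\<lambda>j. info_gain (a j) ?B (\<tau> (Suc k)) (\<tau> k)) \<longlonglongrightarrow> info_gain (l k) ?B (\<tau> (Suc k)) (\<tau> k)"
        proof (rule tendsto_info_gain [OF _ _ _ _ _ _ a_lim])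
          show "l k \<in> {0..1}" using l_bounds [OF k] B by simp
          show "a j \<in> {0..1}" for j using a [of j] B by simp
        qed (use B T in auto)
        have "(\<lambda>j. (1 / b) * (eta (a j) ?B (min (E j) ?B) * info_gain (a j) ?B (\<tau> (Suc k)) (\<tau> k)))
          \<longlonglongrightarrow> (1 / b) * (eta (l k) ?B (min ?D ?B) * info_gain (l k) ?B (\<tau> (Suc k)) (\<tau> k))"
          by (intro tendsto_mult tendsto_const tendsto_eta a_lim tendsto_min E_lim True ig_lim)
        then show ?thesis by (rule LIMSEQ_le [OF _ rhs]) (use le in blast)
      next
        case False
        then have "eta (l k) ?B (min ?D ?B) = 0" by (simp add: eta_def)
        moreover have "0 \<le> H2 (bstar (\<theta> k) ?P) - H2 (bstar (\<theta> (Suc k)) ?P)"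
        proof (rule LIMSEQ_le_const [OF rhs])
          have "0 \<le> (1 / b) * (eta (a j) ?B (min (E j) ?B) * info_gain (a j) ?B (\<tau> (Suc k)) (\<tau> k))" for j
            using assms(2) a [of j] by (intro mult_nonneg_nonneg eta_nonneg ig) auto
          then show "\<exists>N. \<forall>j\<ge>N. 0 \<le> H2 (bstar (\<Theta> (r' j) k) ?P) - H2 (bstar (\<Theta> (r' j) (Suc k)) ?P)"
            using le order_trans by blast
        qed
        ultimately show ?thesis by simp
      qed
    qed
    have main': "\<theta> k \<le> \<theta> (k - 1) \<and>
        0 \<le> (1 / b) * (eta (l (k - 1)) (\<beta> k) (min (D k) (\<beta> k)) * info_gain (l (k - 1)) (\<beta> k) (\<tau> k) (\<tau> (k - 1))) \<and>
        (1 / b) * (eta (l (k - 1)) (\<beta> k) (min (D k) (\<beta> k)) * info_gain (l (k - 1)) (\<beta> k) (\<tau> k) (\<tau> (k - 1)))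
        \<le> H2 (bstar (\<theta> (k - 1)) (p k)) - H2 (bstar (\<theta> k) (p k))" if "k \<in> {1..K}" for k
    proof -
      from that obtain i where "k = Suc i" "i < K" by (cases k) auto
      then show ?thesis using main [of i] by (simp only: diff_Suc_1)
    qed
    show ?thesis
      unfolding C_BBC_def using \<theta>0 \<theta>K main' by blast
  qed
  show ?thesis
    unfolding R_SI_D_outer_def
  \<comment> \<open>Receivers are numbered from 1, the limits \<open>l\<close> from 0; hence the
    shift.\<close>
  proof (intro exI [of _ "\<lambda>k. l (k - 1)"] conjI ballI allI impI)
    fix k assume "k \<in> {1..K}"
    then have k: "k - 1 < K" "Suc (k - 1) = k" "k \<in> {1..K}" by auto
    show "0 \<le> l (k - 1)" "l (k - 1) \<le> 1/2" "l (k - 1) \<le> min (D k) (\<beta> k)"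
      using l_bounds [OF k(1)] \<beta> [OF k(3)] k(2) by auto
  next
    fix \<tau> :: "nat \<Rightarrow> real"
    assume \<tau>: "\<tau> 0 = 1/2 \<and> \<tau> K = 0 \<and> (\<forall>k\<in>{1..K}. \<tau> k \<le> \<tau> (k - 1))"
    have step: "\<forall>k\<in>{0..<K}. \<tau> (k + 1) \<le> \<tau> k"
    proof
      fix k assume "k \<in> {0..<K}"
      then have "k + 1 \<in> {1..K}" by simp
      with \<tau> have "\<tau> (k + 1) \<le> \<tau> (k + 1 - 1)" by blast
      then show "\<tau> (k + 1) \<le> \<tau> k" by simp
    qed
    have "mono \<tau>"
      unfolding mono_def
    proof (intro conjI allI impI)
      fix k assume k: "k \<le> K"
      show "0 \<le> \<tau> k" using antitone_interval [OF step _ k order.refl] \<tau> by simp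
      show "\<tau> k \<le> 1/2" using antitone_interval [OF step order.refl _ k] \<tau> by simp
    qed (use \<tau> step in auto)
    from final [OF this] show "C_BBC K p (\<lambda>k. (1 / b) * (eta (l (k - 1)) (\<beta> k) (min (D k) (\<beta> k)) *
        (H2 (bstar (\<beta> k) (\<tau> k)) - H2 (bstar (\<beta> k) (\<tau> (k - 1)))
          - (H4 (l (k - 1)) (\<beta> k) (\<tau> k) - H4 (l (k - 1)) (\<beta> k) (\<tau> (k - 1))))))"
      unfolding info_gain_def .
  qed
qed

end
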